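(* Let $\nu\in Q^+$. Each simple module of the spin quiver Hecke algebra $\mathcal H^-(\nu)$ is of type $\texttt M$, i.e. it remains simple when its $\mathbb Z_2$-grading is forgotten.
   Context: **Root data.** $\mathbb K$ is a field, $\operatorname{char}\mathbb K\ne2$. $\widetilde\Gamma$ is a finite quiver without loops with vertex set $\widetilde I$, (multi)set of edges $\widetilde H$, source and target maps $\mathrm{src},\mathrm{tgt}:\widetilde H\to\widetilde I$, and $a$ is an automorphism of $\widetilde\Gamma$ commuting with $\mathrm{src},\mathrm{tgt}$ such that no edge joins two vertices in the same $a$-orbit. $I$ is a set of representatives of the $a$-orbits on $\widetilde I$, and $\alpha_i$ is the orbit of $i\in I$. Put $s_i=|\alpha_i|$, $(\alpha_i,\alpha_i)=2s_i$, $(\alpha_i,\alpha_j)=-\#\{\text{edges joining a vertex of }\alpha_i\text{ to a vertex of }\alpha_j\}$ for $i\neq j$, and $a_{ij}=(\alpha_i,\alpha_j)/s_i$. Assume $\gcd\{s_i\}=1$. Put $p(i)=0$ (and $i\in I_{\bar0}$) if $s_i$ is even, $p(i)=1$ (and $i\in I_{\bar1}$) if $s_i$ is odd; so $I_{\bar 1}\ne\emptyset$. Assume $a_{ij}\in2\mathbb Z$ for all $i\in I_{\bar1}$, $j\in I$. Let $d_{ij}$ be the number of $a$-orbits on $\{h\in\widetilde H: \mathrm{src}(h)\in\alpha_i,\mathrm{tgt}(h)\in\alpha_j\}$ and $m(i,j)=\mathrm{lcm}\{(\alpha_i,\alpha_i),(\alpha_j,\alpha_j)\}$; one has $d_{ij}+d_{ji}=-2(\alpha_i,\alpha_j)/m(i,j)$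 for $i\ne j$. $Q^+=\bigoplus_{i\in I}\mathbb Z_{\ge0}\alpha_i$. Set $\mathcal Q_{ii}(u,v)=0$ and, for $i\ne j$, $\mathcal Q_{ij}(u,v)=(-1)^{d_{ij}}\big(u^{m(i,j)/(\alpha_i,\alpha_i)}-v^{m(i,j)/(\alpha_j,\alpha_j)}\big)^{-2(\alpha_i,\alpha_j)/m(i,j)}$ in $\mathbb K\langle u,v\rangle/\langle uv-(-1)^{p(i)p(j)}vu\rangle$. **Spin quiver Hecke algebra.** For $\nu=\sum n_i\alpha_i\in Q^+$ of height $n=\sum n_i$ let $I^\nu=\{\underline i\in I^n:\alpha_{i_1}+\dots+\alpha_{i_n}=\nu\}$; $S_n$ acts by $w\cdot\underline i=(i_{w(1)},\dots,i_{w(n)})$, $s_r=(r,r+1)$. $\mathcal H^-(\nu)$ is the unital $\mathbb K$-algebra with generators $e(\underline i)$ ($\underline i\in I^\nu$), $y_1,\dots,y_n$, $\tau_1,\dots,\tau_{n-1}$ and relations: $e(\underline i)e(\underline j)=\delta_{\underline i,\underline j}e(\underline i)$; $\sum_{\underline i}e(\underline i)=1$; $y_re(\underline i)=e(\underline i)y_r$; $\tau_re(\underline i)=e(s_r\cdot\underline i)\tau_r$; $y_ry_se(\underline i)=(-1)^{p(i_r)p(i_s)}y_sy_re(\underline i)$ for $r\ne s$; $\tau_ry_se(\underline i)=(-1)^{p(i_r)p(i_{r+1})p(i_s)}y_s\tau_re(\underline i)$ for $s\ne r,r+1$; $\tau_r\tau_se(\underline i)=(-1)^{p(i_r)p(i_{r+1})p(i_s)p(i_{s+1})}\tau_s\tau_re(\underline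 i)$ for $|r-s|>1$; $\tau_ry_{r+1}e(\underline i)=\big((-1)^{p(i_r)p(i_{r+1})}y_r\tau_r+\delta_{i_r,i_{r+1}}\big)e(\underline i)$; $y_{r+1}\tau_re(\underline i)=\big((-1)^{p(i_r)p(i_{r+1})}\tau_ry_r+\delta_{i_r,i_{r+1}}\big)e(\underline i)$; $\tau_r^2e(\underline i)=\mathcal Q_{i_r,i_{r+1}}(y_r,y_{r+1})e(\underline i)$; and $(\tau_r\tau_{r+1}\tau_r-\tau_{r+1}\tau_r\tau_{r+1})e(\underline i)$ equals $\frac{\mathcal Q_{i_r,i_{r+1}}(y_{r+2},y_{r+1})-\mathcal Q_{i_r,i_{r+1}}(y_r,y_{r+1})}{y_{r+2}-y_r}e(\underline i)$ if $i_r=i_{r+2}\in I_{\bar0}$, equals $(-1)^{p(i_{r+1})}(y_{r+2}-y_r)\frac{\mathcal Q_{i_r,i_{r+1}}(y_{r+2},y_{r+1})-\mathcal Q_{i_r,i_{r+1}}(y_r,y_{r+1})}{y_{r+2}^2-y_r^2}e(\underline i)$ if $i_r=i_{r+2}\in I_{\bar1}$, and $0$ otherwise. It is $\mathbb Z\times\mathbb Z_2$-graded: $\deg e(\underline i)=0$, $\deg y_re(\underline i)=(\alpha_{i_r},\alpha_{i_r})$, $\deg\tau_re(\underline i)=-(\alpha_{i_r},\alpha_{i_{r+1}})$, with parities $0$, $p(i_r)$, $p(i_r)p(i_{r+1})$. **Modules.** Modules are finitely generated $\mathbb Z\times\mathbb Z_2$-graded left $\mathcal H^-(\nu)$-modules,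 with morphisms preserving both gradings; a simple module is a simple object of this category (it is finite dimensional). A finite-dimensional simple ($\mathbb Z_2$-graded) module over a superalgebra is of type $\texttt M$ if it remains simple with the $\mathbb Z_2$-grading forgotten, and of type $\texttt Q$ otherwise; it is of type $\texttt Q$ iff there is an even isomorphism $\Pi S\cong S$, where $\Pi$ is the parity shift. *)

theory Defs
  imports
    "HOL-Algebra.Algebra"
    "HOL-Combinatorics.Orbits"
    "HOL-Combinatorics.Multiset_Permutations"
    "HOL-Library.Poly_Mapping"
    "HOL-Library.Product_Plus"
    "HOL-Library.Z2"
    "Graph_Theory.Digraph"
begin

section \<open>Free associative algebras\<close>

text \<open>The free monoid on \<open>'g\<close>, written additively, so that finitely supported functions on it,
  with the convolution product of \<^theory>\<open>HOL-Library.Poly_Mapping\<close>, form the free unital algebra.\<close>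

datatype 'g fword = Word (letters: "'g list")

instantiation fword :: (type) monoid_add
begin
definition "0 = Word []"
definition "v + w = Word (letters v @ letters w)"
instance by standard (auto simp: zero_fword_def plus_fword_def)
end

definition letter :: "'g \<Rightarrow> ('g fword \<Rightarrow>\<^sub>0 'k::field)" where
  "letter g = Poly_Mapping.single (Word [g]) 1"

definition scalar :: "'k::field \<Rightarrow> ('g fword \<Rightarrow>\<^sub>0 'k)" where
  "scalar c = Poly_Mapping.single 0 c"

definition free_algebra :: "'g set \<Rightarrow> ('g fword \<Rightarrow>\<^sub>0 'k::field) ring" where
  "free_algebra A =
     \<lparr>carrier = {f. \<forall>w \<in> Poly_Mapping.keys f. set (letters w) \<subseteq> A},
      monoid.mult = (*), one = 1, ring.zero = 0, ring.add = (+)\<rparr>"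

lemma free_algebra_simps [simp]:
  "monoid.mult (free_algebra A) = (*)" "one (free_algebra A) = 1"
  "ring.zero (free_algebra A) = 0" "ring.add (free_algebra A) = (+)"
  by (simp_all add: free_algebra_def)

lemma free_algebra_carrier_iff:
  "f \<in> carrier (free_algebra A) \<longleftrightarrow> (\<forall>w \<in> Poly_Mapping.keys f. set (letters w) \<subseteq> A)"
  by (simp add: free_algebra_def)

lemma free_algebra_closed:
  "letter g \<in> carrier (free_algebra A) \<longleftrightarrow> g \<in> A"
  "scalar c \<in> carrier (free_algebra A)"
  "0 \<in> carrier (free_algebra A)"
  "1 \<in> carrier (free_algebra A)"
  "x \<in> carrier (free_algebra A) \<Longrightarrow> y \<in> carrier (free_algebra A) \<Longrightarrow> x + y \<in> carrier (free_algebra A)"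
  "x \<in> carrier (free_algebra A) \<Longrightarrow> - x \<in> carrier (free_algebra A)"
  "x \<in> carrier (free_algebra A) \<Longrightarrow> y \<in> carrier (free_algebra A) \<Longrightarrow> x - y \<in> carrier (free_algebra A)"
  "x \<in> carrier (free_algebra A) \<Longrightarrow> y \<in> carrier (free_algebra A) \<Longrightarrow> x * y \<in> carrier (free_algebra A)"
proof -
  show "letter g \<in> carrier (free_algebra A) \<longleftrightarrow> g \<in> A"
    by (simp add: free_algebra_carrier_iff letter_def)
  show "scalar c \<in> carrier (free_algebra A)"
    by (simp add: free_algebra_carrier_iff scalar_def zero_fword_def)
  show "0 \<in> carrier (free_algebra A)" by (simp add: free_algebra_carrier_iff)
  show "1 \<in> carrier (free_algebra A)"
    by (simp add: free_algebra_carrier_iff zero_fword_def)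
  show "x + y \<in> carrier (free_algebra A)"
    if "x \<in> carrier (free_algebra A)" "y \<in> carrier (free_algebra A)"
    using that Poly_Mapping.keys_add[of x y] by (fastforce simp: free_algebra_carrier_iff)
  show "- x \<in> carrier (free_algebra A)" if "x \<in> carrier (free_algebra A)"
    using that by (simp add: free_algebra_carrier_iff in_keys_iff)
  show "x - y \<in> carrier (free_algebra A)"
    if "x \<in> carrier (free_algebra A)" "y \<in> carrier (free_algebra A)"
    using that keys_diff[of x y] by (fastforce simp: free_algebra_carrier_iff)
  show "x * y \<in> carrier (free_algebra A)"
    if "x \<in> carrier (free_algebra A)" "y \<in> carrier (free_algebra A)"
    using that keys_mult[of x y] by (fastforce simp: free_algebra_carrier_iff plus_fword_def)
qed

lemma free_algebra_closed_power:
  "x \<in> carrier (free_algebra A) \<Longrightarrow> x ^ k \<in> carrier (free_algebra A)"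
  by (induction k) (auto intro: free_algebra_closed)

lemma free_algebra_closed_sum:
  "(\<And>s. s \<in> S \<Longrightarrow> f s \<in> carrier (free_algebra A)) \<Longrightarrow> sum f S \<in> carrier (free_algebra A)"
  by (induction S rule: infinite_finite_induct) (auto intro: free_algebra_closed)

lemma ring_free_algebra: "ring (free_algebra A)"
proof (rule ringI)
  show "abelian_group (free_algebra A)"
    by (rule abelian_groupI)
      (auto simp: free_algebra_closed add_ac
         intro!: bexI[where x = "- x" for x, OF _ free_algebra_closed(6)])
  show "monoid (free_algebra A)"
    by (rule monoidI) (auto simp: free_algebra_closed mult.assoc)
qed (auto simp: distrib_left distrib_right)

section \<open>Graded modules over (noncommutative) rings\<close>

text \<open>The library's \<^locale>\<open>module\<close> is restricted to commutative rings; its notion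
  \<^locale>\<open>submodule\<close> is not.\<close>

locale left_module = R?: ring R + M?: abelian_group M
  for R :: "('r, 'p) ring_scheme" (structure) and M :: "('r, 'm, 'q) module_scheme" (structure) +
  assumes smult_closed:
      "\<lbrakk>a \<in> carrier R; x \<in> carrier M\<rbrakk> \<Longrightarrow> a \<odot>\<^bsub>M\<^esub> x \<in> carrier M"
    and smult_l_distr:
      "\<lbrakk>a \<in> carrier R; b \<in> carrier R; x \<in> carrier M\<rbrakk> \<Longrightarrow>
        (a \<oplus>\<^bsub>R\<^esub> b) \<odot>\<^bsub>M\<^esub> x = a \<odot>\<^bsub>M\<^esub> x \<oplus>\<^bsub>M\<^esub> b \<odot>\<^bsub>M\<^esub> x"
    and smult_r_distr:
      "\<lbrakk>a \<in> carrier R; x \<in> carrier M; y \<in> carrier M\<rbrakk> \<Longrightarrow>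
        a \<odot>\<^bsub>M\<^esub> (x \<oplus>\<^bsub>M\<^esub> y) = a \<odot>\<^bsub>M\<^esub> x \<oplus>\<^bsub>M\<^esub> a \<odot>\<^bsub>M\<^esub> y"
    and smult_assoc:
      "\<lbrakk>a \<in> carrier R; b \<in> carrier R; x \<in> carrier M\<rbrakk> \<Longrightarrow>
        (a \<otimes>\<^bsub>R\<^esub> b) \<odot>\<^bsub>M\<^esub> x = a \<odot>\<^bsub>M\<^esub> (b \<odot>\<^bsub>M\<^esub> x)"
    and smult_one: "x \<in> carrier M \<Longrightarrow> \<one>\<^bsub>R\<^esub> \<odot>\<^bsub>M\<^esub> x = x"

definition finitely_generated_module ::
    "('r, 'p) ring_scheme \<Rightarrow> ('r, 'm, 'q) module_scheme \<Rightarrow> bool" where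
  "finitely_generated_module R M \<longleftrightarrow>
     (\<exists>S. finite S \<and> S \<subseteq> carrier M \<and> (\<forall>N. submodule N R M \<and> S \<subseteq> N \<longrightarrow> N = carrier M))"

text \<open>A choice of components \<open>f d \<in> Md d\<close>, almost all of them zero, with sum \<open>x\<close>.\<close>

definition decomposition ::
    "('r, 'm, 'q) module_scheme \<Rightarrow> ('d \<Rightarrow> 'm set) \<Rightarrow> 'm \<Rightarrow> ('d \<Rightarrow> 'm) \<Rightarrow> bool" where
  "decomposition M Md x f \<longleftrightarrow>
     (\<forall>d. f d \<in> Md d) \<and> finite {d. f d \<noteq> \<zero>\<^bsub>M\<^esub>} \<and> finsum M f {d. f d \<noteq> \<zero>\<^bsub>M\<^esub>} = x"

text \<open>\<open>Rd\<close> and \<open>Md\<close> are the families of homogeneous components of the ring and of the module.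
  The objects of the category of graded modules are finitely generated.\<close>

definition graded_module ::
    "('r, 'p) ring_scheme \<Rightarrow> ('d::ab_group_add \<Rightarrow> 'r set) \<Rightarrow>
     ('r, 'm, 'q) module_scheme \<Rightarrow> ('d \<Rightarrow> 'm set) \<Rightarrow> bool" where
  "graded_module R Rd M Md \<longleftrightarrow>
     left_module R M \<and>
     finitely_generated_module R M \<and>
     (\<forall>d. subgroup (Md d) (add_monoid M)) \<and>
     (\<forall>x \<in> carrier M. \<exists>!f. decomposition M Md x f) \<and>
     (\<forall>c d. \<forall>r \<in> Rd c. \<forall>x \<in> Md d. r \<odot>\<^bsub>M\<^esub> x \<in> Md (c + d))"

definition graded_submodule ::
    "'m set \<Rightarrow> ('r, 'p) ring_scheme \<Rightarrow> ('r, 'm, 'q) module_scheme \<Rightarrow> ('d \<Rightarrow> 'm set) \<Rightarrow> bool" where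
  "graded_submodule N R M Md \<longleftrightarrow>
     submodule N R M \<and> (\<forall>x \<in> N. \<forall>f. decomposition M Md x f \<longrightarrow> (\<forall>d. f d \<in> N))"

definition graded_simple ::
    "('r, 'p) ring_scheme \<Rightarrow> ('d::ab_group_add \<Rightarrow> 'r set) \<Rightarrow>
     ('r, 'm, 'q) module_scheme \<Rightarrow> ('d \<Rightarrow> 'm set) \<Rightarrow> bool" where
  "graded_simple R Rd M Md \<longleftrightarrow>
     graded_module R Rd M Md \<and> carrier M \<noteq> {\<zero>\<^bsub>M\<^esub>} \<and>
     (\<forall>N. graded_submodule N R M Md \<longrightarrow> N = {\<zero>\<^bsub>M\<^esub>} \<or> N = carrier M)"

definition simple_module ::
    "('r, 'p) ring_scheme \<Rightarrow> ('r, 'm, 'q) module_scheme \<Rightarrow> bool" where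
  "simple_module R M \<longleftrightarrow>
     left_module R M \<and> carrier M \<noteq> {\<zero>\<^bsub>M\<^esub>} \<and>
     (\<forall>N. submodule N R M \<longrightarrow> N = {\<zero>\<^bsub>M\<^esub>} \<or> N = carrier M)"

text \<open>A simple module over a superalgebra has type M if it is simple as an ungraded module;
  this does not depend on the grading of the module.\<close>

definition type_M ::
    "('r, 'p) ring_scheme \<Rightarrow> ('r, 'm, 'q) module_scheme \<Rightarrow> bool" where
  "type_M R S \<longleftrightarrow> simple_module R S"

text \<open>The \<open>\<int>\<close>-grading underlying a \<open>\<int> \<times> \<int>\<^sub>2\<close>-grading, for rings as well as for modules.\<close>

definition forget_parity :: "('r, 'p) ring_scheme \<Rightarrow> (int \<times> bit \<Rightarrow> 'r set) \<Rightarrow> (int \<Rightarrow> 'r set)" where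
  "forget_parity R Rd c = Rd (c, 0) <+>\<^bsub>R\<^esub> Rd (c, 1)"

section \<open>Quivers with automorphism\<close>

datatype 'v spin_gen =
    E_gen "'v list"  \<comment> \<open>\<open>e(i)\<close>\<close>
  | Y_gen nat        \<comment> \<open>\<open>y\<^sub>1, \<dots>, y\<^sub>n\<close> are \<open>Y_gen 0, \<dots>, Y_gen (n - 1)\<close>\<close>
  | T_gen nat        \<comment> \<open>\<open>\<tau>\<^sub>1, \<dots>, \<tau>\<^sub>n\<^sub>-\<^sub>1\<close> are \<open>T_gen 0, \<dots>, T_gen (n - 2)\<close>\<close>

type_synonym ('v, 'k) spin_free = "'v spin_gen fword \<Rightarrow>\<^sub>0 'k"

abbreviation gE :: "'v list \<Rightarrow> ('v, 'k::field) spin_free" where "gE is \<equiv> letter (E_gen is)"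
abbreviation gY :: "nat \<Rightarrow> ('v, 'k::field) spin_free" where "gY r \<equiv> letter (Y_gen r)"
abbreviation gT :: "nat \<Rightarrow> ('v, 'k::field) spin_free" where "gT r \<equiv> letter (T_gen r)"

text \<open>The action \<open>s\<^sub>r \<cdot> i\<close> of a simple transposition on sequences (positions counted from 0).\<close>

definition swap :: "nat \<Rightarrow> 'v list \<Rightarrow> 'v list" where
  "swap r is = permute_list (transpose r (Suc r)) is"

text \<open>The automorphism is given by \<open>aV\<close> on vertices and \<open>aE\<close> on edges. The root \<open>\<alpha>\<^sub>i\<close>
  is the orbit \<open>orbit aV i\<close>; on a finite set, \<^const>\<open>orbit\<close> contains its base point.\<close>

locale quiver_automorphism =
  fin_digraph \<Gamma> + loopfree_digraph \<Gamma> for \<Gamma> :: "('v, 'h) pre_digraph" +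
  fixes aV :: "'v \<Rightarrow> 'v" and aE :: "'h \<Rightarrow> 'h" and I :: "'v set"
  assumes aV_bij: "bij_betw aV (verts \<Gamma>) (verts \<Gamma>)"
    and aE_bij: "bij_betw aE (arcs \<Gamma>) (arcs \<Gamma>)"
    and aE_tail: "h \<in> arcs \<Gamma> \<Longrightarrow> tail \<Gamma> (aE h) = aV (tail \<Gamma> h)"
    and aE_head: "h \<in> arcs \<Gamma> \<Longrightarrow> head \<Gamma> (aE h) = aV (head \<Gamma> h)"
    and no_arc_in_orbit: "h \<in> arcs \<Gamma> \<Longrightarrow> head \<Gamma> h \<notin> orbit aV (tail \<Gamma> h)"
    and I_verts: "I \<subseteq> verts \<Gamma>"
    and I_representatives: "x \<in> verts \<Gamma> \<Longrightarrow> \<exists>!i. i \<in> I \<and> x \<in> orbit aV i"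
begin

definition orb_size :: "'v \<Rightarrow> nat" where
  "orb_size i = card (orbit aV i)"

definition form :: "'v \<Rightarrow> 'v \<Rightarrow> int" where
  "form i j =
     (if i = j then 2 * int (orb_size i)
      else - int (card {h \<in> arcs \<Gamma>.
        tail \<Gamma> h \<in> orbit aV i \<and> head \<Gamma> h \<in> orbit aV j \<or>
        tail \<Gamma> h \<in> orbit aV j \<and> head \<Gamma> h \<in> orbit aV i}))"

definition cartan :: "'v \<Rightarrow> 'v \<Rightarrow> rat" where
  "cartan i j = of_int (form i j) / of_nat (orb_size i)"

definition par :: "'v \<Rightarrow> nat" where
  "par i = (if even (orb_size i) then 0 else 1)"

definition d_num :: "'v \<Rightarrow> 'v \<Rightarrow> nat" where
  "d_num i j = card (orbit aE ` {h \<in> arcs \<Gamma>. tail \<Gamma> h \<in> orbit aV i \<and> head \<Gamma> h \<in> orbit aV j})"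

definition m_lcm :: "'v \<Rightarrow> 'v \<Rightarrow> int" where
  "m_lcm i j = lcm (form i i) (form j j)"

text \<open>The exponents in
  \<open>\<Q>\<^sub>i\<^sub>j(u,v) = \<plusminus> (u\<^bsup>Q_exp i j\<^esup> - v\<^bsup>Q_exp j i\<^esup>)\<^bsup>Q_deg i j\<^esup>\<close>.
  The division in \<open>Q_deg\<close> is exact by the assumption \<open>d_sum\<close> of the locale \<open>spin_quiver\<close>.\<close>

definition Q_exp :: "'v \<Rightarrow> 'v \<Rightarrow> nat" where
  "Q_exp i j = nat (m_lcm i j div form i i)"

definition Q_deg :: "'v \<Rightarrow> 'v \<Rightarrow> nat" where
  "Q_deg i j = nat ((- 2 * form i j) div m_lcm i j)"

definition Q_poly :: "'v \<Rightarrow> 'v \<Rightarrow> 'r::ring_1 \<Rightarrow> 'r \<Rightarrow> 'r" where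
  "Q_poly i j u v =
     (if i = j then 0
      else (- 1) ^ d_num i j * (u ^ Q_exp i j - v ^ Q_exp j i) ^ Q_deg i j)"

text \<open>The quotient \<open>(\<Q>\<^sub>i\<^sub>j(u',v) - \<Q>\<^sub>i\<^sub>j(u,v)) / (u' - u)\<close> for \<open>i\<close> even, where all
  variables commute; see \<open>Q_quot_even\<close> below.\<close>

definition Q_quot0 :: "'v \<Rightarrow> 'v \<Rightarrow> 'r::ring_1 \<Rightarrow> 'r \<Rightarrow> 'r \<Rightarrow> 'r" where
  "Q_quot0 i j u' u v =
     (let a = Q_exp i j; b = Q_exp j i; c = Q_deg i j in
      if i = j then 0
      else (- 1) ^ d_num i j * (\<Sum>k<c. (u' ^ a - v ^ b) ^ k * (u ^ a - v ^ b) ^ (c - 1 - k)) *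
             (\<Sum>l<a. u' ^ l * u ^ (a - 1 - l)))"

text \<open>The quotient \<open>(\<Q>\<^sub>i\<^sub>j(u',v) - \<Q>\<^sub>i\<^sub>j(u,v)) / (u'\<^sup>2 - u\<^sup>2)\<close> for \<open>i\<close> odd, where \<open>u\<close> and
  \<open>u'\<close> anticommute and both commute with \<open>v\<close> up to the sign \<open>(-1)\<^bsup>p(j)\<^esup>\<close>; see \<open>Q_quot_odd\<close>
  below. The denominator is central in the ring of skew polynomials in \<open>u\<close>, \<open>u'\<close>, \<open>v\<close>, which is a
  domain, so the quotient is unique. If \<open>a\<close> is even then \<open>u\<^bsup>a\<^esup>\<close> is a power of \<open>u\<^sup>2\<close>; otherwise
  \<open>j\<close> is odd, \<open>c\<close> is even and \<open>(u\<^bsup>a\<^esup> - v\<^bsup>b\<^esup>)\<^sup>2 = u\<^bsup>2a\<^esup> + v\<^bsup>2b\<^esup>\<close>.\<close>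

definition Q_quot1 :: "'v \<Rightarrow> 'v \<Rightarrow> 'r::ring_1 \<Rightarrow> 'r \<Rightarrow> 'r \<Rightarrow> 'r" where
  "Q_quot1 i j u' u v =
     (let a = Q_exp i j; b = Q_exp j i; c = Q_deg i j in
      if i = j then 0
      else if even a then
        (- 1) ^ d_num i j * (\<Sum>k<c. (u' ^ a - v ^ b) ^ k * (u ^ a - v ^ b) ^ (c - 1 - k)) *
          (\<Sum>l<a div 2. (u'^2) ^ l * (u^2) ^ (a div 2 - 1 - l))
      else
        (- 1) ^ d_num i j *
          (\<Sum>k<c div 2. ((u' ^ a - v ^ b)^2) ^ k * ((u ^ a - v ^ b)^2) ^ (c div 2 - 1 - k)) *
          (\<Sum>l<a. (u'^2) ^ l * (u^2) ^ (a - 1 - l)))"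

section \<open>The spin quiver Hecke algebra\<close>

text \<open>An element \<open>\<nu>\<close> of \<open>Q\<^sup>+\<close> is a multiset of elements of \<open>I\<close>, and \<open>I\<^sup>\<nu>\<close> is
  \<open>permutations_of_multiset \<nu>\<close>, the set of lists with underlying multiset \<open>\<nu>\<close>.\<close>

definition generators :: "'v multiset \<Rightarrow> 'v spin_gen set" where
  "generators \<nu> =
     E_gen ` permutations_of_multiset \<nu> \<union> Y_gen ` {r. r < size \<nu>} \<union> T_gen ` {r. Suc r < size \<nu>}"

text \<open>Each element of this set is the difference of the two sides of a defining relation.\<close>

definition relators :: "'v multiset \<Rightarrow> ('v, 'k::field) spin_free set" where
  "relators \<nu> = (let n = size \<nu>; I\<nu> = permutations_of_multiset \<nu> in
     {gE is * gE js - (if is = js then gE is else 0) | is js. is \<in> I\<nu> \<and> js \<in> I\<nu>}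
   \<union> {(\<Sum>is\<in>I\<nu>. gE is) - 1}
   \<union> {gY r * gE is - gE is * gY r | r is. r < n \<and> is \<in> I\<nu>}
   \<union> {gT r * gE is - gE (swap r is) * gT r | r is. Suc r < n \<and> is \<in> I\<nu>}
   \<union> {gY r * gY t * gE is - (- 1) ^ (par (is!r) * par (is!t)) * gY t * gY r * gE is | r t is.
        r < n \<and> t < n \<and> r \<noteq> t \<and> is \<in> I\<nu>}
   \<union> {gT r * gY t * gE is
        - (- 1) ^ (par (is!r) * par (is!Suc r) * par (is!t)) * gY t * gT r * gE is | r t is.
        Suc r < n \<and> t < n \<and> t \<noteq> r \<and> t \<noteq> Suc r \<and> is \<in> I\<nu>}
   \<union> {gT r * gT t * gE is
        - (- 1) ^ (par (is!r) * par (is!Suc r) * par (is!t) * par (is!Suc t)) * gT t * gT r * gE is | r t is.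
        Suc r < n \<and> Suc t < n \<and> (Suc r < t \<or> Suc t < r) \<and> is \<in> I\<nu>}
   \<union> {gT r * gY (Suc r) * gE is
        - ((- 1) ^ (par (is!r) * par (is!Suc r)) * gY r * gT r
            + (if is!r = is!Suc r then 1 else 0)) * gE is | r is.
        Suc r < n \<and> is \<in> I\<nu>}
   \<union> {gY (Suc r) * gT r * gE is
        - ((- 1) ^ (par (is!r) * par (is!Suc r)) * gT r * gY r
            + (if is!r = is!Suc r then 1 else 0)) * gE is | r is.
        Suc r < n \<and> is \<in> I\<nu>}
   \<union> {gT r * gT r * gE is - Q_poly (is!r) (is!Suc r) (gY r) (gY (Suc r)) * gE is | r is.
        Suc r < n \<and> is \<in> I\<nu>}
   \<union> {(gT r * gT (Suc r) * gT r - gT (Suc r) * gT r * gT (Suc r)) * gE is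
        - (if is!r = is!Suc (Suc r) then
             (if par (is!r) = 0
              then Q_quot0 (is!r) (is!Suc r) (gY (Suc (Suc r))) (gY r) (gY (Suc r))
              else (- 1) ^ par (is!Suc r) * (gY (Suc (Suc r)) - gY r) *
                   Q_quot1 (is!r) (is!Suc r) (gY (Suc (Suc r))) (gY r) (gY (Suc r)))
           else 0) * gE is | r is.
        Suc (Suc r) < n \<and> is \<in> I\<nu>})"

definition relation_ideal :: "'v multiset \<Rightarrow> ('v, 'k::field) spin_free set" where
  "relation_ideal \<nu> = genideal (free_algebra (generators \<nu>)) (relators \<nu>)"

definition spin_algebra :: "'v multiset \<Rightarrow> ('v, 'k::field) spin_free set ring" where
  "spin_algebra \<nu> = free_algebra (generators \<nu>) Quot relation_ideal \<nu>"

text \<open>The \<open>\<int> \<times> \<int>\<^sub>2\<close>-grading is generated by the degrees of \<open>e(i)\<close>, \<open>y\<^sub>r e(i)\<close> and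
  \<open>\<tau>\<^sub>r e(i)\<close>; the \<open>y\<^sub>r\<close> and \<open>\<tau>\<^sub>r\<close> themselves are not homogeneous.\<close>

inductive homogeneous :: "'v multiset \<Rightarrow> int \<times> bit \<Rightarrow> ('v, 'k::field) spin_free \<Rightarrow> bool" for \<nu> where
  idem: "is \<in> permutations_of_multiset \<nu> \<Longrightarrow> homogeneous \<nu> (0, 0) (gE is)"
| dot: "is \<in> permutations_of_multiset \<nu> \<Longrightarrow> r < size \<nu> \<Longrightarrow>
    homogeneous \<nu> (form (is!r) (is!r), of_nat (par (is!r))) (gY r * gE is)"
| crossing: "is \<in> permutations_of_multiset \<nu> \<Longrightarrow> Suc r < size \<nu> \<Longrightarrow>
    homogeneous \<nu> (- form (is!r) (is!Suc r), of_nat (par (is!r) * par (is!Suc r))) (gT r * gE is)"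
| mult: "homogeneous \<nu> c x \<Longrightarrow> homogeneous \<nu> c' y \<Longrightarrow> homogeneous \<nu> (c + c') (x * y)"
| zero: "homogeneous \<nu> c 0"
| add: "homogeneous \<nu> c x \<Longrightarrow> homogeneous \<nu> c y \<Longrightarrow> homogeneous \<nu> c (x + y)"
| scale: "homogeneous \<nu> c x \<Longrightarrow> homogeneous \<nu> c (scalar b * x)"

definition spin_component :: "'v multiset \<Rightarrow> int \<times> bit \<Rightarrow> ('v, 'k::field) spin_free set set" where
  "spin_component \<nu> c =
     (\<lambda>x. relation_ideal \<nu> +>\<^bsub>free_algebra (generators \<nu>)\<^esub> x) ` {x. homogeneous \<nu> c x}"

end

text \<open>The identity \<open>d_sum\<close> is part of the standing setup: it says that every orbit of edges
  between \<open>\<alpha>\<^sub>i\<close> and \<open>\<alpha>\<^sub>j\<close> has \<open>lcm (orb_size i) (orb_size j)\<close> elements, which is not automatic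
  in the presence of parallel edges.\<close>

locale spin_quiver = quiver_automorphism +
  assumes gcd_orb_size: "Gcd (orb_size ` I) = 1"
    and cartan_even: "i \<in> I \<Longrightarrow> par i = 1 \<Longrightarrow> j \<in> I \<Longrightarrow> \<exists>k::int. cartan i j = of_int (2 * k)"
    and d_sum: "i \<in> I \<Longrightarrow> j \<in> I \<Longrightarrow> i \<noteq> j \<Longrightarrow>
      int (d_num i j + d_num j i) * m_lcm i j = - 2 * form i j"

section \<open>Well-definedness\<close>

lemma diff_power_telescope:
  fixes x y :: "'r::ring_1"
  assumes "x * y = y * x"
  shows "(\<Sum>k<n. x ^ k * y ^ (n - 1 - k)) * (x - y) = x ^ n - y ^ n"
proof (induction n)
  case (Suc n)
  have "(\<Sum>k<n. x ^ k * y ^ (n - k)) = (\<Sum>k<n. x ^ k * y ^ (n - 1 - k)) * y"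
    unfolding sum_distrib_right
  proof (rule sum.cong)
    fix k assume "k \<in> {..<n}"
    then have "n - k = Suc (n - 1 - k)" by auto
    then show "x ^ k * y ^ (n - k) = x ^ k * y ^ (n - 1 - k) * y"
      by (simp add: mult.assoc power_commutes)
  qed simp
  then have e: "(\<Sum>k<Suc n. x ^ k * y ^ (Suc n - 1 - k))
      = (\<Sum>k<n. x ^ k * y ^ (n - 1 - k)) * y + x ^ n"
    by simp
  have "y * (x - y) = (x - y) * y" by (simp add: algebra_simps assms)
  then have "(\<Sum>k<n. x ^ k * y ^ (n - 1 - k)) * y * (x - y)
      = (\<Sum>k<n. x ^ k * y ^ (n - 1 - k)) * (x - y) * y"
    by (simp only: mult.assoc)
  also have "\<dots> = (x ^ n - y ^ n) * y" by (simp only: Suc.IH)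
  finally have "(\<Sum>k<n. x ^ k * y ^ (n - 1 - k)) * y * (x - y) + x ^ n * (x - y)
      = x ^ Suc n - y ^ Suc n"
    by (simp add: left_diff_distrib right_diff_distrib power_commutes)
  then show ?case
    by (simp only: e distrib_right)
qed simp

lemma skew_power_left:
  fixes x y :: "'r::ring_1"
  assumes "x * y = (- 1) ^ e * (y * x)"
  shows "x ^ k * y = (- 1) ^ (e * k) * (y * x ^ k)"
proof (induction k)
  case (Suc k)
  have c: "x * (- 1) ^ n = (- 1) ^ n * x" for n
    by (cases "even n") auto
  have "x ^ Suc k * y = x * ((- 1) ^ (e * k) * (y * x ^ k))"
    by (simp add: mult.assoc Suc)
  also have "\<dots> = (- 1) ^ (e * k) * ((x * y) * x ^ k)"
    by (metis c mult.assoc)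
  also have "\<dots> = (- 1) ^ (e * Suc k) * (y * x ^ Suc k)"
    by (simp add: assms mult.assoc power_add) (metis mult.assoc power_add add.commute)
  finally show ?case .
qed simp

lemma skew_power:
  fixes x y :: "'r::ring_1"
  assumes "x * y = (- 1) ^ e * (y * x)"
  shows "x ^ k * y ^ l = (- 1) ^ (e * k * l) * (y ^ l * x ^ k)"
proof -
  have "y * x ^ k = (- 1) ^ (e * k) * (x ^ k * y)"
    using skew_power_left[OF assms, of k] by (cases "even (e * k)") auto
  from skew_power_left[OF this, of l] show ?thesis
    by (cases "even (e * k * l)") auto
qed

context spin_quiver
begin

lemma relators_closed:
  "(relators \<nu> :: ('a, 'k::field) spin_free set) \<subseteq> carrier (free_algebra (generators \<nu>))"
proof -
  let ?F = "carrier (free_algebra (generators \<nu>)) :: ('a, 'k::field) spin_free set"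
  have E: "gE is \<in> ?F" if "is \<in> permutations_of_multiset \<nu>" for "is"
    using that by (simp add: free_algebra_closed generators_def)
  have Y: "gY r \<in> ?F" if "r < size \<nu>" for r
    using that by (auto simp add: free_algebra_closed generators_def)
  have T: "gT r \<in> ?F" if "Suc r < size \<nu>" for r
    using that by (auto simp add: free_algebra_closed generators_def)
  have sw: "swap r is \<in> permutations_of_multiset \<nu>"
    if "is \<in> permutations_of_multiset \<nu>" "Suc r < size \<nu>" for r "is"
  proof -
    have "length is = size \<nu>" using that by (auto simp: permutations_of_multiset_def)
    then have "transpose r (Suc r) permutes {..<length is}"
      using that by (auto intro: permutes_swap_id)
    then show ?thesis
      using that by (simp add: swap_def permutations_of_multiset_def)
  qed
  note cl = free_algebra_closed(3-) free_algebra_closed_power free_algebra_closed_sum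
  have Q: "Q_poly i j u v \<in> ?F" if "u \<in> ?F" "v \<in> ?F" for i j u v
    using that unfolding Q_poly_def by (auto intro!: cl)
  have Q0: "Q_quot0 i j u' u v \<in> ?F" if "u' \<in> ?F" "u \<in> ?F" "v \<in> ?F" for i j u' u v
    using that unfolding Q_quot0_def Let_def by (auto intro!: cl)
  have Q1: "Q_quot1 i j u' u v \<in> ?F" if "u' \<in> ?F" "u \<in> ?F" "v \<in> ?F" for i j u' u v
    using that unfolding Q_quot1_def Let_def by (auto intro!: cl)
  show ?thesis
    unfolding relators_def Let_def
    by (auto intro!: cl E Y T sw Q Q0 Q1)
qed

lemma ring_spin_algebra: "ring (spin_algebra \<nu>)"
  unfolding spin_algebra_def relation_ideal_def
  by (rule ideal.quotient_is_ring[OF ring.genideal_ideal[OF ring_free_algebra relators_closed]])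

lemma Q_quot_even:
  fixes u u' v :: "'r::ring_1"
  assumes "u' * u = u * u'" "u * v = v * u" "u' * v = v * u'"
  shows "Q_quot0 i j u' u v * (u' - u) = Q_poly i j u' v - Q_poly i j u v"
proof (cases "i = j")
  case False
  define a b c where "a = Q_exp i j" and "b = Q_exp j i" and "c = Q_deg i j"
  have "u' ^ a * u ^ a = u ^ a * u' ^ a" "u ^ a * v ^ b = v ^ b * u ^ a"
    "u' ^ a * v ^ b = v ^ b * u' ^ a"
    using assms skew_power[of u' u 0 a a] skew_power[of u v 0 a b] skew_power[of u' v 0 a b]
    by simp_all
  then have "(u' ^ a - v ^ b) * (u ^ a - v ^ b) = (u ^ a - v ^ b) * (u' ^ a - v ^ b)"
    by (simp add: algebra_simps)
  from diff_power_telescope[OF this, of c] diff_power_telescope[OF assms(1), of a] False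
  show ?thesis
    by (simp add: Q_quot0_def Q_poly_def mult.assoc flip: a_def b_def c_def right_diff_distrib)
qed (simp add: Q_quot0_def Q_poly_def)

lemma orb_size_pos: "i \<in> I \<Longrightarrow> orb_size i > 0"
proof -
  assume "i \<in> I"
  have "x \<in> verts \<Gamma>" if "x \<in> orbit aV i" for x
    using that by induction (use \<open>i \<in> I\<close> I_verts aV_bij in \<open>auto simp: bij_betw_def\<close>)
  then have "orbit aV i \<subseteq> verts \<Gamma>" by (rule subsetI)
  then have "finite (orbit aV i)" by (rule finite_subset) (rule finite_verts)
  moreover have "aV i \<in> orbit aV i" by (rule orbit.base)
  ultimately show ?thesis by (auto simp: orb_size_def card_gt_0_iff)
qed

lemma Q_exp_orb_size: "i \<in> I \<Longrightarrow> j \<in> I \<Longrightarrow> Q_exp i j * orb_size i = lcm (orb_size i) (orb_size j)"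
proof -
  assume ij: "i \<in> I" "j \<in> I"
  have "m_lcm i j = int (2 * lcm (orb_size i) (orb_size j))"
    by (simp add: m_lcm_def form_def lcm_mult_left flip: of_nat_mult)
  moreover have "form i i = int (2 * orb_size i)" by (simp add: form_def)
  ultimately have "Q_exp i j = (2 * lcm (orb_size i) (orb_size j)) div (2 * orb_size i)"
    unfolding Q_exp_def by (simp only: nat_int flip: zdiv_int)
  then have "Q_exp i j = lcm (orb_size i) (orb_size j) div orb_size i" by simp
  then show ?thesis by simp
qed

lemma Q_quot_odd:
  fixes u u' v :: "'r::ring_1"
  assumes "i \<in> I" "j \<in> I" "par i = 1" "u' * u = - (u * u')"
    and "u * v = (- 1) ^ par j * (v * u)" "u' * v = (- 1) ^ par j * (v * u')"
  shows "Q_quot1 i j u' u v * (u'^2 - u^2) = Q_poly i j u' v - Q_poly i j u v"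
proof (cases "i = j")
  case False
  define a b c where "a = Q_exp i j" and "b = Q_exp j i" and "c = Q_deg i j"
  define z where "z = u ^ a - v ^ b"
  define z' where "z' = u' ^ a - v ^ b"
  have si: "odd (orb_size i)" using assms(3) by (auto simp: par_def split: if_splits)
  have A: "a * orb_size i = lcm (orb_size i) (orb_size j)"
    using Q_exp_orb_size[OF assms(1,2)] by (simp add: a_def)
  have B: "b * orb_size j = lcm (orb_size i) (orb_size j)"
    using Q_exp_orb_size[OF assms(2,1)] by (simp add: b_def lcm.commute)
  have uu: "u' ^ k * u ^ l = (- 1) ^ (k * l) * (u ^ l * u' ^ k)" for k l
    using skew_power[of u' u 1 k l] assms(4) by simp
  have uv: "u ^ a * v ^ b = (- 1) ^ (par j * a * b) * (v ^ b * u ^ a)"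
    "u' ^ a * v ^ b = (- 1) ^ (par j * a * b) * (v ^ b * u' ^ a)"
    by (rule skew_power[OF assms(5)], rule skew_power[OF assms(6)])
  have sq: "u'^2 * u^2 = u^2 * u'^2" using uu[of 2 2] by simp
  have fact: "Q_quot1 i j u' u v * (u'^2 - u^2) = (- 1) ^ d_num i j * (z' ^ c - z ^ c)"
  proof (cases "even a")
    case True
    then have "u ^ a * v ^ b = v ^ b * u ^ a" "u' ^ a * v ^ b = v ^ b * u' ^ a"
      "u' ^ a * u ^ a = u ^ a * u' ^ a"
      using uv uu[of a a] by simp_all
    then have "z' * z = z * z'" by (simp add: z_def z'_def algebra_simps)
    note t = diff_power_telescope[OF this, of c]
    have "(u'^2) ^ (a div 2) - (u^2) ^ (a div 2) = z' - z"
      using True by (simp add: z_def z'_def flip: power_mult)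
    then show ?thesis
      using diff_power_telescope[OF sq, of "a div 2"] t True False
      by (simp add: Q_quot1_def mult.assoc flip: a_def b_def c_def z_def z'_def)
  next
    case odd: False
    then have L: "odd (lcm (orb_size i) (orb_size j))" using A si by (metis even_mult_iff)
    then have sj: "odd (orb_size j)" "odd b" using B by (metis even_mult_iff)+
    then have pj: "par j = 1" by (simp add: par_def)
    have anti: "u ^ a * v ^ b = - (v ^ b * u ^ a)" "u' ^ a * v ^ b = - (v ^ b * u' ^ a)"
      using uv odd sj pj by simp_all
    have z2: "z^2 = (u^2) ^ a + (v^2) ^ b" "z'^2 = (u'^2) ^ a + (v^2) ^ b"
    proof -
      have "(w^2) ^ n = w ^ n * w ^ n" for w :: 'r and n
        by (metis mult.commute power2_eq_square power_mult)
      then show "z^2 = (u^2) ^ a + (v^2) ^ b" "z'^2 = (u'^2) ^ a + (v^2) ^ b"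
        using anti by (simp_all add: z_def z'_def power2_eq_square[of "_ - _"] algebra_simps)
    qed
    have even_c: "even c"
    proof -
      obtain k :: int where "cartan i j = of_int (2 * k)"
        using cartan_even assms by blast
      then have "(of_int (form i j) :: rat) = of_int (2 * k * int (orb_size i))"
        using orb_size_pos[OF assms(1)] by (simp add: cartan_def field_simps)
      then have f: "form i j = 2 * k * int (orb_size i)" by (simp only: of_int_eq_iff)
      have m: "m_lcm i j = 2 * int (lcm (orb_size i) (orb_size j))"
        by (simp add: m_lcm_def form_def lcm_mult_left flip: of_nat_mult)
      have "int (d_num i j + d_num j i) * int (lcm (orb_size i) (orb_size j))
          = 2 * (- k * int (orb_size i))"
        using d_sum[OF assms(1,2) False] unfolding m f by (simp add: mult.commute)
      then have "even (int (d_num i j + d_num j i) * int (lcm (orb_size i) (orb_size j)))"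
        by simp
      then have "even (d_num i j + d_num j i)"
        using L by (metis even_mult_iff even_of_nat)
      moreover have "c = d_num i j + d_num j i"
      proof -
        have "m_lcm i j \<noteq> 0" using m L by (metis even_zero mult_eq_0_iff of_nat_eq_0_iff zero_neq_numeral)
        then have "(- 2 * form i j) div m_lcm i j = int (d_num i j + d_num j i)"
          using d_sum[OF assms(1,2) False] by (metis nonzero_mult_div_cancel_right)
        then show ?thesis by (simp only: c_def Q_deg_def nat_int)
      qed
      ultimately show ?thesis by simp
    qed
    have v2: "w^2 * v^2 = v^2 * w^2" if "w = u \<or> w = u'" for w
      using that skew_power[OF assms(5), of 2 2] skew_power[OF assms(6), of 2 2] by auto
    have "(u'^2) ^ a * (u^2) ^ a = (u^2) ^ a * (u'^2) ^ a"
      "(u^2) ^ a * (v^2) ^ b = (v^2) ^ b * (u^2) ^ a"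
      "(u'^2) ^ a * (v^2) ^ b = (v^2) ^ b * (u'^2) ^ a"
      using skew_power[of "u'^2" "u^2" 0 a a] skew_power[of "u^2" "v^2" 0 a b]
        skew_power[of "u'^2" "v^2" 0 a b] sq v2 by simp_all
    then have "z'^2 * z^2 = z^2 * z'^2" by (simp add: z2 algebra_simps)
    note t = diff_power_telescope[OF this, of "c div 2"]
    have "(u'^2) ^ a - (u^2) ^ a = z'^2 - z^2" by (simp add: z2)
    moreover have "(z^2) ^ (c div 2) = z ^ c" "(z'^2) ^ (c div 2) = z' ^ c"
      using even_c by (simp_all flip: power_mult)
    ultimately show ?thesis
      using diff_power_telescope[OF sq, of a] t odd False
      by (simp add: Q_quot1_def mult.assoc flip: a_def b_def c_def z_def z'_def)
  qed
  then show ?thesis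
    using False by (simp add: Q_poly_def z_def z'_def a_def b_def c_def right_diff_distrib)
qed (simp add: Q_quot1_def Q_poly_def)

end

end

(* The parity of a weight-homogeneous element of the algebra is determined by its integer degree:
   all values of the form are even, and along a path of generators from e(i) to e(j) the parity
   differs from half of the degree by a sum, over the inversions of i and j, of a defect that
   depends on the two colours only. Hence, once the parity on M is corrected by half of the degree
   and by this sum, the algebra acts by even operators, and graded simplicity forces every space
   e(i)M_c to be concentrated in one parity.

   The integer degrees of M are bounded below, because the dots do not lower the degree and finitely
   many words in the crossings suffice. So if N is a nonzero submodule and x is a weight vector in N
   with top component x', some element of the algebra takes x' to a nonzero vector of the lowest
   degree of M and kills the other components of x for degree reasons. Thus N contains a nonzero
   homogeneous vector, and N = M. *)

theory Submission
  imports Defs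
begin

section \<open>Graded modules\<close>

text \<open>A submodule that ignores the grading can fail to be homogeneous through a single
  coincidence: a weight vector with two components of equal integer degree and opposite parity, such
  as \<open>x + \<phi> x\<close> for an odd endomorphism \<open>\<phi>\<close> of degree 0. Degree
  considerations cannot separate these two. Purity of weight spaces excludes exactly this case: on a
  weight space the integer degree already determines the bidegree, so the top component of a weight
  vector is unique.

  The parity defect can be integrated along crossings because it is symmetric, vanishes for equal
  colours and takes values mod 2. Summed over the inversions for any fixed order of the colours, it
  changes at each crossing by the defect of that crossing, whichever way the two strands pass.

  A truncation of M from below is not a submodule, since a crossing of equal colours lowers the
  degree. It is therefore enlarged to a subgroup stable under the whole algebra, by finitely many
  operations each of which lowers the degree bound by a finite amount. Finite generation turns this
  subgroup into M itself.\<close>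

context left_module
begin

lemma smult_zero_right:
  assumes "a \<in> carrier R"
  shows "a \<odot>\<^bsub>M\<^esub> \<zero>\<^bsub>M\<^esub> = \<zero>\<^bsub>M\<^esub>"
proof -
  have "a \<odot>\<^bsub>M\<^esub> \<zero>\<^bsub>M\<^esub> = a \<odot>\<^bsub>M\<^esub> \<zero>\<^bsub>M\<^esub> \<oplus>\<^bsub>M\<^esub> a \<odot>\<^bsub>M\<^esub> \<zero>\<^bsub>M\<^esub>"
    using smult_r_distr[OF assms, of "\<zero>\<^bsub>M\<^esub>" "\<zero>\<^bsub>M\<^esub>"] by simp
  then show ?thesis
    using smult_closed[OF assms M.zero_closed] by (metis M.add.r_cancel_one')
qed

lemma smult_zero_left:
  assumes "x \<in> carrier M"
  shows "\<zero>\<^bsub>R\<^esub> \<odot>\<^bsub>M\<^esub> x = \<zero>\<^bsub>M\<^esub>"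
proof -
  have "\<zero>\<^bsub>R\<^esub> \<odot>\<^bsub>M\<^esub> x = \<zero>\<^bsub>R\<^esub> \<odot>\<^bsub>M\<^esub> x \<oplus>\<^bsub>M\<^esub> \<zero>\<^bsub>R\<^esub> \<odot>\<^bsub>M\<^esub> x"
    using smult_l_distr[OF R.zero_closed R.zero_closed assms] by simp
  then show ?thesis
    using smult_closed[OF R.zero_closed assms] by (metis M.add.r_cancel_one')
qed

lemma smult_minus_right:
  assumes "a \<in> carrier R" "x \<in> carrier M"
  shows "a \<odot>\<^bsub>M\<^esub> (\<ominus>\<^bsub>M\<^esub> x) = \<ominus>\<^bsub>M\<^esub> (a \<odot>\<^bsub>M\<^esub> x)"
proof -
  have "a \<odot>\<^bsub>M\<^esub> (\<ominus>\<^bsub>M\<^esub> x) \<oplus>\<^bsub>M\<^esub> a \<odot>\<^bsub>M\<^esub> x = \<zero>\<^bsub>M\<^esub>"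
    using assms smult_r_distr[of a "\<ominus>\<^bsub>M\<^esub> x" x] by (simp add: M.l_neg smult_zero_right)
  then show ?thesis
    using assms by (metis M.minus_equality smult_closed M.a_inv_closed)
qed

lemma smult_minus_left:
  assumes "a \<in> carrier R" "x \<in> carrier M"
  shows "(\<ominus>\<^bsub>R\<^esub> a) \<odot>\<^bsub>M\<^esub> x = \<ominus>\<^bsub>M\<^esub> (a \<odot>\<^bsub>M\<^esub> x)"
proof -
  have "(\<ominus>\<^bsub>R\<^esub> a) \<odot>\<^bsub>M\<^esub> x \<oplus>\<^bsub>M\<^esub> a \<odot>\<^bsub>M\<^esub> x = \<zero>\<^bsub>M\<^esub>"
    using assms smult_l_distr[of "\<ominus>\<^bsub>R\<^esub> a" a x] by (simp add: R.l_neg smult_zero_left)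
  then show ?thesis
    using assms by (metis M.minus_equality smult_closed R.a_inv_closed)
qed

lemma smult_finsum:
  assumes "a \<in> carrier R" "f \<in> A \<rightarrow> carrier M"
  shows "a \<odot>\<^bsub>M\<^esub> finsum M f A = finsum M (\<lambda>i. a \<odot>\<^bsub>M\<^esub> f i) A"
  using assms(2)
proof (induction A rule: infinite_finite_induct)
  case (insert x A)
  then show ?case
    using assms(1) by (simp add: Pi_def smult_r_distr smult_closed)
qed (use assms(1) in \<open>simp_all add: smult_zero_right\<close>)

lemma additive_subgroupI:
  assumes "N \<subseteq> carrier M" "\<zero>\<^bsub>M\<^esub> \<in> N" "\<And>x. x \<in> N \<Longrightarrow> \<ominus>\<^bsub>M\<^esub> x \<in> N"
    "\<And>x y. x \<in> N \<Longrightarrow> y \<in> N \<Longrightarrow> x \<oplus>\<^bsub>M\<^esub> y \<in> N"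
  shows "subgroup N (add_monoid M)"
  using assms by (auto intro!: M.add.subgroupI simp flip: a_inv_def)

lemma additive_subgroupD:
  assumes "subgroup N (add_monoid M)"
  shows "N \<subseteq> carrier M" "\<zero>\<^bsub>M\<^esub> \<in> N" "x \<in> N \<Longrightarrow> \<ominus>\<^bsub>M\<^esub> x \<in> N" "x \<in> N \<Longrightarrow> y \<in> N \<Longrightarrow> x \<oplus>\<^bsub>M\<^esub> y \<in> N"
    "x \<in> N \<Longrightarrow> x \<in> carrier M"
proof -
  interpret N: subgroup N "add_monoid M" by (rule assms)
  show "N \<subseteq> carrier M" "\<zero>\<^bsub>M\<^esub> \<in> N" "x \<in> N \<Longrightarrow> \<ominus>\<^bsub>M\<^esub> x \<in> N" "x \<in> N \<Longrightarrow> y \<in> N \<Longrightarrow> x \<oplus>\<^bsub>M\<^esub> y \<in> N"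
    "x \<in> N \<Longrightarrow> x \<in> carrier M"
    using N.subset N.one_closed N.m_inv_closed[of x] N.m_closed[of x y] by (auto simp: a_inv_def)
qed

lemma submoduleI:
  assumes "N \<subseteq> carrier M" "\<zero>\<^bsub>M\<^esub> \<in> N"
    and "\<And>x. x \<in> N \<Longrightarrow> \<ominus>\<^bsub>M\<^esub> x \<in> N"
    and "\<And>x y. x \<in> N \<Longrightarrow> y \<in> N \<Longrightarrow> x \<oplus>\<^bsub>M\<^esub> y \<in> N"
    and "\<And>a x. a \<in> carrier R \<Longrightarrow> x \<in> N \<Longrightarrow> a \<odot>\<^bsub>M\<^esub> x \<in> N"
  shows "submodule N R M"
  by (intro submodule.intro submodule_axioms.intro additive_subgroupI assms)

lemma submoduleE:
  assumes "submodule N R M"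
  shows "N \<subseteq> carrier M" "\<zero>\<^bsub>M\<^esub> \<in> N"
    and "\<And>a x. a \<in> carrier R \<Longrightarrow> x \<in> N \<Longrightarrow> a \<odot>\<^bsub>M\<^esub> x \<in> N"
  using additive_subgroupD(1,2)[OF submodule.axioms(1)[OF assms]] submodule.smult_closed[OF assms]
  by auto

end

section \<open>Components of vectors in a graded module\<close>

locale graded_left_module =
  fixes R :: "('r, 'p) ring_scheme" and Rd :: "'d::ab_group_add \<Rightarrow> 'r set"
    and M :: "('r, 'm, 'q) module_scheme" and Md :: "'d \<Rightarrow> 'm set"
  assumes graded: "graded_module R Rd M Md"
    and Rd_carrier: "Rd c \<subseteq> carrier R"
begin

sublocale left_module R M
  using graded by (simp add: graded_module_def)

definition component :: "'m \<Rightarrow> 'd \<Rightarrow> 'm" where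
  "component x = (THE f. decomposition M Md x f)"

lemma Md_subgroup: "subgroup (Md d) (add_monoid M)"
  using graded by (simp add: graded_module_def)

lemma Md_closed:
  "x \<in> Md d \<Longrightarrow> x \<in> carrier M" "\<zero>\<^bsub>M\<^esub> \<in> Md d"
  "x \<in> Md d \<Longrightarrow> \<ominus>\<^bsub>M\<^esub> x \<in> Md d"
  "x \<in> Md d \<Longrightarrow> y \<in> Md d \<Longrightarrow> x \<oplus>\<^bsub>M\<^esub> y \<in> Md d"
  by (rule additive_subgroupD[OF Md_subgroup]; assumption)+

lemma smult_Md: "r \<in> Rd c \<Longrightarrow> x \<in> Md d \<Longrightarrow> r \<odot>\<^bsub>M\<^esub> x \<in> Md (c + d)"
  using graded by (simp add: graded_module_def)

lemma component_decomposition: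
  assumes "x \<in> carrier M"
  shows "decomposition M Md x (component x)"
proof -
  have "\<exists>!f. decomposition M Md x f" using graded assms by (simp add: graded_module_def)
  then show ?thesis unfolding component_def by (rule theI')
qed

lemma decomposition_carrier:
  assumes "decomposition M Md x f"
  shows "x \<in> carrier M"
  using assms Md_closed(1) unfolding decomposition_def by (auto intro: M.finsum_closed)

lemma decomposition_unique:
  assumes "decomposition M Md x f"
  shows "component x = f"
proof -
  have "\<exists>!f. decomposition M Md x f"
    using graded decomposition_carrier[OF assms] by (simp add: graded_module_def)
  then show ?thesis
    using assms component_decomposition[OF decomposition_carrier[OF assms]] by blast
qed

text \<open>\<open>S\<close> may exceed the support of \<open>f\<close>. Supports need not be
  computed exactly, for instance where components cancel in a sum.\<close>

lemma component_eqI: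
  assumes "finite S" "\<And>d. f d \<in> Md d" "\<And>d. d \<notin> S \<Longrightarrow> f d = \<zero>\<^bsub>M\<^esub>" "finsum M f S = x"
  shows "component x = f"
proof (rule decomposition_unique)
  have sub: "{d. f d \<noteq> \<zero>\<^bsub>M\<^esub>} \<subseteq> S" using assms(3) by auto
  have "finsum M f {d. f d \<noteq> \<zero>\<^bsub>M\<^esub>} = finsum M f S"
    by (rule M.add.finprod_mono_neutral_cong_left)
      (use assms(1,2) sub Md_closed(1) in auto)
  then show "decomposition M Md x f"
    using assms finite_subset[OF sub] by (simp add: decomposition_def)
qed

lemma component_mem: "x \<in> carrier M \<Longrightarrow> component x d \<in> Md d"
  using component_decomposition by (simp add: decomposition_def)

lemma component_closed: "x \<in> carrier M \<Longrightarrow> component x d \<in> carrier M"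
  by (rule Md_closed(1)[OF component_mem])

lemma finite_component: "x \<in> carrier M \<Longrightarrow> finite {d. component x d \<noteq> \<zero>\<^bsub>M\<^esub>}"
  using component_decomposition by (simp add: decomposition_def)

lemma finsum_component:
  assumes "x \<in> carrier M" "finite S" "{d. component x d \<noteq> \<zero>\<^bsub>M\<^esub>} \<subseteq> S"
  shows "finsum M (component x) S = x"
proof -
  have "finsum M (component x) {d. component x d \<noteq> \<zero>\<^bsub>M\<^esub>} = finsum M (component x) S"
    by (rule M.add.finprod_mono_neutral_cong_left)
      (use assms component_closed in auto)
  then show ?thesis
    using component_decomposition[OF assms(1)] by (simp add: decomposition_def)
qed

lemma component_inject:
  assumes "x \<in> carrier M" "y \<in> carrier M" "\<And>d. component x d = component y d"
  shows "x = y"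
proof -
  have "component x = component y" using assms(3) by auto
  then show ?thesis
    using component_decomposition[OF assms(1)] component_decomposition[OF assms(2)]
    by (simp add: decomposition_def)
qed

lemma component_homogeneous:
  assumes "x \<in> Md d"
  shows "component x = (\<lambda>d'. if d' = d then x else \<zero>\<^bsub>M\<^esub>)"
proof (rule component_eqI[of "{d}"])
  show "finsum M (\<lambda>d'. if d' = d then x else \<zero>\<^bsub>M\<^esub>) {d} = x"
    using assms Md_closed(1) by (subst M.finsum_insert) auto
qed (use assms Md_closed in auto)

lemma component_zero: "component \<zero>\<^bsub>M\<^esub> d = \<zero>\<^bsub>M\<^esub>"
  using component_homogeneous[OF Md_closed(2)] by simp

lemma component_add:
  assumes "x \<in> carrier M" "y \<in> carrier M"
  shows "component (x \<oplus>\<^bsub>M\<^esub> y) d = component x d \<oplus>\<^bsub>M\<^esub> component y d"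
proof -
  let ?S = "{d. component x d \<noteq> \<zero>\<^bsub>M\<^esub>} \<union> {d. component y d \<noteq> \<zero>\<^bsub>M\<^esub>}"
  have "component (x \<oplus>\<^bsub>M\<^esub> y) = (\<lambda>d. component x d \<oplus>\<^bsub>M\<^esub> component y d)"
  proof (rule component_eqI[of ?S])
    show "finite ?S" using assms finite_component by simp
    then show "(\<Oplus>\<^bsub>M\<^esub>d\<in>?S. component x d \<oplus>\<^bsub>M\<^esub> component y d) = x \<oplus>\<^bsub>M\<^esub> y"
      using assms component_closed by (simp add: finsum_component)
  qed (use assms component_mem Md_closed in auto)
  then show ?thesis by simp
qed

lemma component_minus:
  assumes "x \<in> carrier M"
  shows "component (\<ominus>\<^bsub>M\<^esub> x) d = \<ominus>\<^bsub>M\<^esub> component x d"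
proof -
  have "component x d \<oplus>\<^bsub>M\<^esub> component (\<ominus>\<^bsub>M\<^esub> x) d = \<zero>\<^bsub>M\<^esub>"
    using component_add[of x "\<ominus>\<^bsub>M\<^esub> x" d] assms component_zero by (simp add: M.r_neg)
  then show ?thesis
    using assms component_closed by (metis M.minus_equality M.add.m_comm M.a_inv_closed)
qed

lemma component_smult:
  assumes "r \<in> Rd c" "x \<in> carrier M"
  shows "component (r \<odot>\<^bsub>M\<^esub> x) d = r \<odot>\<^bsub>M\<^esub> component x (d - c)"
proof -
  have r: "r \<in> carrier R" using assms(1) Rd_carrier by auto
  let ?S = "{d. component x d \<noteq> \<zero>\<^bsub>M\<^esub>}"
  have "component (r \<odot>\<^bsub>M\<^esub> x) = (\<lambda>d. r \<odot>\<^bsub>M\<^esub> component x (d - c))"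
  \<comment> \<open>The translate of the support of \<open>x\<close> may exceed the support of the
    product, since \<open>r\<close> may kill components.\<close>
  proof (rule component_eqI[of "(+) c ` ?S"])
    show "finite ((+) c ` ?S)" using finite_component[OF assms(2)] by simp
    show "r \<odot>\<^bsub>M\<^esub> component x (d - c) \<in> Md d" for d
      using smult_Md[OF assms(1) component_mem[OF assms(2)], of "d - c"] by simp
    show "r \<odot>\<^bsub>M\<^esub> component x (d - c) = \<zero>\<^bsub>M\<^esub>" if "d \<notin> (+) c ` ?S" for d
    proof -
      have "d - c \<notin> ?S" using that by (metis (no_types) diff_add_cancel image_eqI add.commute)
      then show ?thesis using smult_zero_right[OF r] by simp
    qed
    have "(\<Oplus>\<^bsub>M\<^esub>d\<in>(+) c ` ?S. r \<odot>\<^bsub>M\<^esub> component x (d - c)) = (\<Oplus>\<^bsub>M\<^esub>d\<in>?S. r \<odot>\<^bsub>M\<^esub> component x d)"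
      by (subst M.finsum_reindex)
        (use assms(2) component_closed smult_closed[OF r] in auto)
    also have "\<dots> = r \<odot>\<^bsub>M\<^esub> x"
      using assms(2) component_closed finite_component finsum_component
      by (simp flip: smult_finsum[OF r])
    finally show "(\<Oplus>\<^bsub>M\<^esub>d\<in>(+) c ` ?S. r \<odot>\<^bsub>M\<^esub> component x (d - c)) = r \<odot>\<^bsub>M\<^esub> x" .
  qed
  then show ?thesis by simp
qed

lemma component_finsum:
  assumes "g \<in> A \<rightarrow> carrier M"
  shows "component (finsum M g A) d = finsum M (\<lambda>a. component (g a) d) A"
  using assms
proof (induction A rule: infinite_finite_induct)
  case (insert a A)
  then show ?case by (simp add: Pi_def component_closed component_add)
qed (simp_all add: component_zero)

end

section \<open>Submodules assembled from stable graded families\<close>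

locale spanned_graded_left_module = graded_left_module +
  \<comment> \<open>An induction rule expressing that every scalar is a finite sum of homogeneous
    ones. It asserts a sum, not a direct sum.\<close>
  assumes span: "\<lbrakk>a \<in> carrier R; \<And>c r. r \<in> Rd c \<Longrightarrow> r \<in> A;
      \<And>r s. r \<in> carrier R \<Longrightarrow> s \<in> carrier R \<Longrightarrow> r \<in> A \<Longrightarrow> s \<in> A \<Longrightarrow> r \<oplus>\<^bsub>R\<^esub> s \<in> A\<rbrakk> \<Longrightarrow> a \<in> A"
begin

lemma submodule_of_graded_family:
  assumes mem: "\<And>d. G d \<subseteq> Md d" and zero: "\<And>d. \<zero>\<^bsub>M\<^esub> \<in> G d"
    and minus: "\<And>d x. x \<in> G d \<Longrightarrow> \<ominus>\<^bsub>M\<^esub> x \<in> G d"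
    and add: "\<And>d x y. x \<in> G d \<Longrightarrow> y \<in> G d \<Longrightarrow> x \<oplus>\<^bsub>M\<^esub> y \<in> G d"
    and smult: "\<And>c d r x. r \<in> Rd c \<Longrightarrow> x \<in> G d \<Longrightarrow> r \<odot>\<^bsub>M\<^esub> x \<in> G (c + d)"
  shows "graded_submodule {x \<in> carrier M. \<forall>d. component x d \<in> G d} R M Md" (is "graded_submodule ?N _ _ _")
  unfolding graded_submodule_def
proof (intro conjI ballI allI impI)
  have cl: "x \<oplus>\<^bsub>M\<^esub> y \<in> ?N" if "x \<in> ?N" "y \<in> ?N" for x y
    using that add by (simp add: component_add)
  show "submodule ?N R M"
  proof (rule submoduleI)
    fix a x assume a: "a \<in> carrier R" and x: "x \<in> ?N"
    \<comment> \<open>The scalars that keep \<open>x\<close> in the candidate are closed under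
      addition, so \<open>span\<close> leaves only homogeneous scalars to check.\<close>
    have "a \<in> {a \<in> carrier R. a \<odot>\<^bsub>M\<^esub> x \<in> ?N}"
    proof (rule span[OF a])
      fix c r assume r: "r \<in> Rd c"
      then have "r \<in> carrier R" using Rd_carrier by blast
      moreover have "r \<odot>\<^bsub>M\<^esub> component x (d - c) \<in> G d" for d
        using smult[OF r, of "component x (d - c)" "d - c"] x by simp
      ultimately show "r \<in> {a \<in> carrier R. a \<odot>\<^bsub>M\<^esub> x \<in> ?N}"
        using x by (simp add: component_smult[OF r] smult_closed)
    next
      fix r s assume "r \<in> {a \<in> carrier R. a \<odot>\<^bsub>M\<^esub> x \<in> ?N}" "s \<in> {a \<in> carrier R. a \<odot>\<^bsub>M\<^esub> x \<in> ?N}"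
      then show "r \<oplus>\<^bsub>R\<^esub> s \<in> {a \<in> carrier R. a \<odot>\<^bsub>M\<^esub> x \<in> ?N}"
        using x cl by (simp add: smult_l_distr)
    qed
    then show "a \<odot>\<^bsub>M\<^esub> x \<in> ?N" by simp
  qed (use cl zero minus in \<open>auto simp: component_zero component_minus\<close>)
next
  fix x f d assume x: "x \<in> ?N" and f: "decomposition M Md x f"
  have f: "f = component x" using decomposition_unique[OF f] by simp
  have "component x d \<in> G d" using x by simp
  moreover have "component (component x d) = (\<lambda>d'. if d' = d then component x d else \<zero>\<^bsub>M\<^esub>)"
    using x component_mem by (intro component_homogeneous) auto
  ultimately show "f d \<in> ?N"
    using x zero component_closed by (auto simp: f)
qed

text \<open>Graded simplicity in the form in which it is applied, once to an orbit of a homogeneous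
  vector and once to the vectors of the expected parity.\<close>

lemma graded_simple_family:
  assumes simple: "graded_simple R Rd M Md"
    and mem: "\<And>d. G d \<subseteq> Md d" and zero: "\<And>d. \<zero>\<^bsub>M\<^esub> \<in> G d"
    and minus: "\<And>d x. x \<in> G d \<Longrightarrow> \<ominus>\<^bsub>M\<^esub> x \<in> G d"
    and add: "\<And>d x y. x \<in> G d \<Longrightarrow> y \<in> G d \<Longrightarrow> x \<oplus>\<^bsub>M\<^esub> y \<in> G d"
    and smult: "\<And>c d r x. r \<in> Rd c \<Longrightarrow> x \<in> G d \<Longrightarrow> r \<odot>\<^bsub>M\<^esub> x \<in> G (c + d)"
    and nonzero: "x0 \<in> G d0" "x0 \<noteq> \<zero>\<^bsub>M\<^esub>"
  shows "G = Md"
proof -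
  let ?N = "{x \<in> carrier M. \<forall>d. component x d \<in> G d}"
  have "?N = {\<zero>\<^bsub>M\<^esub>} \<or> ?N = carrier M"
    using simple submodule_of_graded_family[OF mem zero minus add smult] by (simp add: graded_simple_def)
  moreover have x0: "x0 \<in> Md d0" using nonzero(1) mem by blast
  then have "x0 \<in> ?N"
    using nonzero(1) zero Md_closed(1)[OF x0] by (simp add: component_homogeneous[OF x0])
  ultimately have N: "?N = carrier M" using nonzero(2) by blast
  show ?thesis
  proof (intro ext subset_antisym mem subsetI)
    fix d x assume x: "x \<in> Md d"
    then have "component x d \<in> G d" using N Md_closed(1) by blast
    then show "x \<in> G d" using component_homogeneous[OF x] by simp
  qed
qed

text \<open>The multiples of \<open>x\<close> by homogeneous scalars form a stable graded family,
  and it contains \<open>x\<close> as the multiple by one.\<close>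

lemma graded_simple_transitive:
  assumes simple: "graded_simple R Rd M Md"
    and Rd_add: "\<And>c r s. r \<in> Rd c \<Longrightarrow> s \<in> Rd c \<Longrightarrow> r \<oplus>\<^bsub>R\<^esub> s \<in> Rd c"
    and Rd_minus: "\<And>c r. r \<in> Rd c \<Longrightarrow> \<ominus>\<^bsub>R\<^esub> r \<in> Rd c"
    and Rd_zero: "\<And>c. \<zero>\<^bsub>R\<^esub> \<in> Rd c"
    and Rd_mult: "\<And>c c' r s. r \<in> Rd c \<Longrightarrow> s \<in> Rd c' \<Longrightarrow> r \<otimes>\<^bsub>R\<^esub> s \<in> Rd (c + c')"
    and Rd_one: "\<one>\<^bsub>R\<^esub> \<in> Rd 0"
    and x: "x \<in> Md d" "x \<noteq> \<zero>\<^bsub>M\<^esub>" and z: "z \<in> Md d'"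
  shows "\<exists>r \<in> Rd (d' - d). z = r \<odot>\<^bsub>M\<^esub> x"
proof -
  have xc: "x \<in> carrier M" using x(1) by (rule Md_closed)
  have Rdc: "r \<in> carrier R" if "r \<in> Rd c" for r c using that Rd_carrier by blast
  let ?G = "\<lambda>d'. (\<lambda>r. r \<odot>\<^bsub>M\<^esub> x) ` Rd (d' - d)"
  have G: "?G = Md"
  proof (rule graded_simple_family[OF simple])
    show "?G d' \<subseteq> Md d'" for d'
      using smult_Md[OF _ x(1), of _ "d' - d"] by auto
    show "\<zero>\<^bsub>M\<^esub> \<in> ?G d'" for d'
      using Rd_zero smult_zero_left[OF xc] by (metis image_eqI)
    show "\<ominus>\<^bsub>M\<^esub> y \<in> ?G d'" if y: "y \<in> ?G d'" for y d'
    proof -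
      obtain r where "r \<in> Rd (d' - d)" "y = r \<odot>\<^bsub>M\<^esub> x" using y by auto
      then show ?thesis
        using Rd_minus smult_minus_left[OF Rdc xc] by (intro image_eqI[of _ _ "\<ominus>\<^bsub>R\<^esub> r"]) auto
    qed
    show "y \<oplus>\<^bsub>M\<^esub> y' \<in> ?G d'" if y: "y \<in> ?G d'" "y' \<in> ?G d'" for y y' d'
    proof -
      obtain r s where "r \<in> Rd (d' - d)" "s \<in> Rd (d' - d)" "y = r \<odot>\<^bsub>M\<^esub> x" "y' = s \<odot>\<^bsub>M\<^esub> x"
        using y by auto
      then show ?thesis
        using Rd_add smult_l_distr[OF Rdc Rdc xc] by (intro image_eqI[of _ _ "r \<oplus>\<^bsub>R\<^esub> s"]) auto
    qed
    show "r \<odot>\<^bsub>M\<^esub> y \<in> ?G (c + d')" if rc: "r \<in> Rd c" and y: "y \<in> ?G d'" for r c y d'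
    proof -
      obtain s where s: "s \<in> Rd (d' - d)" "y = s \<odot>\<^bsub>M\<^esub> x" using y by auto
      then have "r \<otimes>\<^bsub>R\<^esub> s \<in> Rd (c + d' - d)"
        using Rd_mult[OF rc s(1)] by (simp add: add_diff_eq)
      moreover have "r \<odot>\<^bsub>M\<^esub> y = (r \<otimes>\<^bsub>R\<^esub> s) \<odot>\<^bsub>M\<^esub> x"
        using s rc xc Rdc by (simp add: smult_assoc)
      ultimately show ?thesis by blast
    qed
    show "x \<in> ?G d"
      using Rd_one smult_one[OF xc] by (metis diff_self image_eqI)
    show "x \<noteq> \<zero>\<^bsub>M\<^esub>" by (rule x(2))
  qed
  have "z \<in> ?G d'" unfolding fun_cong[OF G] by (rule z)
  then show ?thesis by blast
qed

end

section \<open>Forgetting the parity\<close>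

lemma forget_parity_mem:
  "x \<in> forget_parity M Md c \<longleftrightarrow> (\<exists>a \<in> Md (c, 0). \<exists>b \<in> Md (c, 1). x = a \<oplus>\<^bsub>M\<^esub> b)"
  by (auto simp: forget_parity_def set_add_defs)

text \<open>A vector has integer degree \<open>c\<close> exactly if its bihomogeneous components
  outside \<open>c\<close> vanish. With this description the axioms can be checked on components,
  and \<open>component_inject\<close> gives uniqueness of decompositions.\<close>

lemma graded_module_forget_parity:
  assumes "graded_left_module R Rd M Md"
  shows "graded_module R (forget_parity R Rd) M (forget_parity M Md)"
proof -
  interpret graded_left_module R Rd M Md by (rule assms)
  have mem: "x \<in> forget_parity M Md c \<longleftrightarrow>
      x \<in> carrier M \<and> (\<forall>d. fst d \<noteq> c \<longrightarrow> component x d = \<zero>\<^bsub>M\<^esub>)" for x c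
  proof
    assume "x \<in> forget_parity M Md c"
    then obtain a b where ab: "a \<in> Md (c, 0)" "b \<in> Md (c, 1)" "x = a \<oplus>\<^bsub>M\<^esub> b"
      by (auto simp: forget_parity_mem)
    then have "a \<in> carrier M" "b \<in> carrier M" using Md_closed(1) by auto
    then show "x \<in> carrier M \<and> (\<forall>d. fst d \<noteq> c \<longrightarrow> component x d = \<zero>\<^bsub>M\<^esub>)"
      by (auto simp: ab(3) component_add component_homogeneous[OF ab(1)] component_homogeneous[OF ab(2)])
  next
    assume x: "x \<in> carrier M \<and> (\<forall>d. fst d \<noteq> c \<longrightarrow> component x d = \<zero>\<^bsub>M\<^esub>)"
    have "d \<in> {(c, 0), (c, 1)}" if "component x d \<noteq> \<zero>\<^bsub>M\<^esub>" for d
      using x that by (cases d) auto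
    then have "finsum M (component x) {(c, 0), (c, 1)} = x"
      using x by (intro finsum_component) auto
    then have "x = component x (c, 0) \<oplus>\<^bsub>M\<^esub> component x (c, 1)"
      using x component_closed by simp
    then show "x \<in> forget_parity M Md c"
      unfolding forget_parity_mem using x component_mem by blast
  qed
  have memD: "x \<in> carrier M" "fst d \<noteq> c \<Longrightarrow> component x d = \<zero>\<^bsub>M\<^esub>"
    if "x \<in> forget_parity M Md c" for x c d
    using that unfolding mem by blast+
  have component_sum: "component (finsum M f {c. f c \<noteq> \<zero>\<^bsub>M\<^esub>}) d = component (f (fst d)) d"
    if f: "\<And>c. f c \<in> forget_parity M Md c" and fin: "finite {c. f c \<noteq> \<zero>\<^bsub>M\<^esub>}" for f :: "int \<Rightarrow> _" and d
  proof -
    let ?S = "{c. f c \<noteq> \<zero>\<^bsub>M\<^esub>}"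
    have fc: "f c \<in> carrier M" for c by (rule memD(1)[OF f])
    have "component (finsum M f ?S) d = finsum M (\<lambda>c. component (f c) d) ?S"
      by (rule component_finsum) (use fc in auto)
    \<comment> \<open>The index \<open>fst d\<close> is put in by hand: it is missing from the
      support when \<open>f (fst d)\<close> is zero.\<close>
    also have "\<dots> = finsum M (\<lambda>c. component (f c) d) (insert (fst d) ?S)"
      by (rule M.add.finprod_mono_neutral_cong_left)
        (use fin fc component_zero component_closed in auto)
    also have "\<dots> = finsum M (\<lambda>c. if fst d = c then component (f c) d else \<zero>\<^bsub>M\<^esub>) (insert (fst d) ?S)"
      by (rule M.finsum_cong') (use memD(2)[OF f] component_closed[OF fc] in auto)
    also have "\<dots> = component (f (fst d)) d"
      by (rule M.finsum_singleton) (use fin component_closed[OF fc] in auto)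
    finally show ?thesis .
  qed
  have unique: "f = g" if f: "decomposition M (forget_parity M Md) x f"
    and g: "decomposition M (forget_parity M Md) x g" for x f g
  proof
    fix c
    have "component (f c) d = component (g c) d" for d
    proof (cases "fst d = c")
      case True
      have "component (h (fst d)) d = component x d" if "decomposition M (forget_parity M Md) x h" for h
        using that component_sum[of h d] by (simp add: decomposition_def)
      then show ?thesis using f g True by metis
    next
      case False
      moreover have "f c \<in> forget_parity M Md c" "g c \<in> forget_parity M Md c"
        using f g by (simp_all add: decomposition_def)
      ultimately show ?thesis using memD(2)[of "f c" c d] memD(2)[of "g c" c d] by simp
    qed
    moreover have "f c \<in> carrier M" "g c \<in> carrier M"
      using f g memD(1) unfolding decomposition_def by blast+
    ultimately show "f c = g c" using component_inject by blast
  qed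
  have exists: "\<exists>f. decomposition M (forget_parity M Md) x f" if x: "x \<in> carrier M" for x
  proof
    let ?f = "\<lambda>c. component x (c, 0) \<oplus>\<^bsub>M\<^esub> component x (c, 1)"
    have f: "?f c \<in> forget_parity M Md c" for c
      unfolding forget_parity_mem using component_mem[OF x] by blast
    have "{c. ?f c \<noteq> \<zero>\<^bsub>M\<^esub>} \<subseteq> fst ` {d. component x d \<noteq> \<zero>\<^bsub>M\<^esub>}"
    proof
      fix c assume "c \<in> {c. ?f c \<noteq> \<zero>\<^bsub>M\<^esub>}"
      then have "component x (c, 0) \<noteq> \<zero>\<^bsub>M\<^esub> \<or> component x (c, 1) \<noteq> \<zero>\<^bsub>M\<^esub>" by auto
      then show "c \<in> fst ` {d. component x d \<noteq> \<zero>\<^bsub>M\<^esub>}"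
      proof
        assume "component x (c, 0) \<noteq> \<zero>\<^bsub>M\<^esub>"
        then show ?thesis by (intro image_eqI[of c fst "(c, 0)"]) simp_all
      next
        assume "component x (c, 1) \<noteq> \<zero>\<^bsub>M\<^esub>"
        then show ?thesis by (intro image_eqI[of c fst "(c, 1)"]) simp_all
      qed
    qed
    then have fin: "finite {c. ?f c \<noteq> \<zero>\<^bsub>M\<^esub>}"
      using finite_component[OF x] finite_surj by blast
    have "finsum M ?f {c. ?f c \<noteq> \<zero>\<^bsub>M\<^esub>} = x"
    proof (rule component_inject[OF _ x])
      show "finsum M ?f {c. ?f c \<noteq> \<zero>\<^bsub>M\<^esub>} \<in> carrier M"
        using f mem by (intro M.finsum_closed) blast
      fix d :: "int \<times> bit"
      obtain c e where d: "d = (c, e)" by (cases d)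
      have "component (finsum M ?f {c. ?f c \<noteq> \<zero>\<^bsub>M\<^esub>}) d = component (?f (fst d)) d"
        by (rule component_sum[OF f fin])
      also have "\<dots> = component (component x (c, 0)) d \<oplus>\<^bsub>M\<^esub> component (component x (c, 1)) d"
        using x by (simp add: d component_add component_closed)
      also have "\<dots> = component x d"
        unfolding component_homogeneous[OF component_mem[OF x]] d
        using component_closed[OF x] by (cases e) auto
      finally show "component (finsum M ?f {c. ?f c \<noteq> \<zero>\<^bsub>M\<^esub>}) d = component x d" .
    qed
    then show "decomposition M (forget_parity M Md) x ?f"
      using f fin by (simp add: decomposition_def)
  qed
  have sub: "subgroup (forget_parity M Md c) (add_monoid M)" for c
  proof (rule additive_subgroupI)
    show "forget_parity M Md c \<subseteq> carrier M" using memD(1) by (rule subsetI)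
    show "\<zero>\<^bsub>M\<^esub> \<in> forget_parity M Md c" unfolding mem using component_zero by simp
    show "\<ominus>\<^bsub>M\<^esub> x \<in> forget_parity M Md c" if x: "x \<in> forget_parity M Md c" for x
      unfolding mem using memD(1)[OF x] memD(2)[OF x] by (simp add: component_minus del: split_paired_All)
    show "x \<oplus>\<^bsub>M\<^esub> y \<in> forget_parity M Md c"
      if x: "x \<in> forget_parity M Md c" and y: "y \<in> forget_parity M Md c" for x y
      unfolding mem using memD[OF x] memD[OF y] by (simp add: component_add del: split_paired_All)
  qed
  have smult: "r \<odot>\<^bsub>M\<^esub> x \<in> forget_parity M Md (c + d)"
    if r: "r \<in> forget_parity R Rd c" and x: "x \<in> forget_parity M Md d" for c d r x
  proof -
    obtain r0 r1 where r01: "r0 \<in> Rd (c, 0)" "r1 \<in> Rd (c, 1)" "r = r0 \<oplus>\<^bsub>R\<^esub> r1"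
      using r by (auto simp: forget_parity_mem)
    have rc: "r0 \<in> carrier R" "r1 \<in> carrier R" using r01 Rd_carrier by blast+
    note xc = memD(1)[OF x] and zero = memD(2)[OF x]
    show ?thesis
      unfolding mem
    proof (intro conjI allI impI)
      show "r \<odot>\<^bsub>M\<^esub> x \<in> carrier M" using rc xc by (simp add: r01(3) smult_closed)
      fix e :: "int \<times> bit" assume e: "fst e \<noteq> c + d"
      then have "fst (e - (c, b)) \<noteq> d" for b by (cases e) auto
      then have "component (r0 \<odot>\<^bsub>M\<^esub> x) e = \<zero>\<^bsub>M\<^esub>" "component (r1 \<odot>\<^bsub>M\<^esub> x) e = \<zero>\<^bsub>M\<^esub>"
        using zero by (simp_all add: component_smult[OF r01(1) xc] component_smult[OF r01(2) xc]
            smult_zero_right rc)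
      then show "component (r \<odot>\<^bsub>M\<^esub> x) e = \<zero>\<^bsub>M\<^esub>"
        using rc xc by (simp add: r01(3) smult_l_distr component_add smult_closed)
    qed
  qed
  have "left_module R M" "finitely_generated_module R M"
    using graded by (simp_all add: graded_module_def)
  then show ?thesis
    unfolding graded_module_def using sub exists unique smult by blast
qed

section \<open>Parity and degree\<close>

lemma free_algebra_induct [consumes 1, case_names scalar letter add mult]:
  assumes x: "x \<in> carrier (free_algebra A)"
    and scalar: "\<And>c. P (scalar c)" and letter: "\<And>g. g \<in> A \<Longrightarrow> P (letter g)"
    and add: "\<And>x y. \<lbrakk>x \<in> carrier (free_algebra A); y \<in> carrier (free_algebra A); P x; P y\<rbrakk> \<Longrightarrow> P (x + y)"
    and mult: "\<And>x y. \<lbrakk>x \<in> carrier (free_algebra A); y \<in> carrier (free_algebra A); P x; P y\<rbrakk> \<Longrightarrow> P (x * y)"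
  shows "P x"
proof -
  let ?F = "carrier (free_algebra A)"
  \<comment> \<open>Membership in the algebra travels along with \<open>P\<close>, because the rules
    for sums and products ask for it.\<close>
  have word: "Poly_Mapping.single (Word gs) c \<in> ?F \<and> P (Poly_Mapping.single (Word gs) c)"
    if "set gs \<subseteq> A" for gs c
    using that
  proof (induction gs)
    case Nil
    show ?case
      using scalar[of c] free_algebra_closed(2)[of c A] by (simp add: scalar_def zero_fword_def)
  next
    case (Cons g gs)
    have "Poly_Mapping.single (Word (g # gs)) c = letter g * Poly_Mapping.single (Word gs) c"
      by (simp add: letter_def mult_single plus_fword_def)
    then show ?case
      using Cons letter[of g] mult[of "letter g" "Poly_Mapping.single (Word gs) c"]
      by (simp add: free_algebra_closed)
  qed
  have x_sum: "x = (\<Sum>w\<in>Poly_Mapping.keys x. Poly_Mapping.single w (poly_mapping.lookup x w))"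
    by (rule poly_mapping_eqI) (simp add: lookup_sum lookup_single when_def in_keys_iff)
  have "(\<Sum>w\<in>K. Poly_Mapping.single w (poly_mapping.lookup x w)) \<in> ?F \<and> P (\<Sum>w\<in>K. Poly_Mapping.single w (poly_mapping.lookup x w))"
    if "finite K" "K \<subseteq> Poly_Mapping.keys x" for K
    using that
  proof (induction K rule: finite_induct)
    case empty
    show ?case using scalar[of 0] by (simp add: free_algebra_closed scalar_def)
  next
    case (insert w K)
    then have "set (letters w) \<subseteq> A" using x by (simp add: free_algebra_carrier_iff)
    from word[OF this, of "poly_mapping.lookup x w"] insert show ?case
      using add by (simp add: free_algebra_closed)
  qed
  from this[of "Poly_Mapping.keys x"] show ?thesis by (simp flip: x_sum)
qed

text \<open>A scalar sits on the empty word, so it commutes with each letter. Over all letters,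
  \<open>free_algebra UNIV\<close> contains every element, which makes the induction
  unconditional.\<close>

lemma scalar_commute: "scalar b * x = x * scalar b"
proof -
  have "x \<in> carrier (free_algebra UNIV)" by (simp add: free_algebra_carrier_iff)
  then show ?thesis
  proof (induction x rule: free_algebra_induct)
    case (mult x y)
    then show ?case by (metis mult.assoc)
  qed (simp_all add: scalar_def letter_def mult_single mult.commute distrib_left distrib_right)
qed

lemma swap_eq:
  assumes "Suc r < length is"
  shows "swap r is = take r is @ is ! Suc r # is ! r # drop (Suc (Suc r)) is"
proof (rule nth_equalityI)
  have p: "transpose r (Suc r) permutes {..<length is}"
    using assms by (auto intro: permutes_swap_id)
  show "length (swap r is) = length (take r is @ is ! Suc r # is ! r # drop (Suc (Suc r)) is)"
    using assms by (simp add: swap_def)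
  fix k assume "k < length (swap r is)"
  then have k: "k < length is" by (simp add: swap_def)
  have "swap r is ! k = is ! transpose r (Suc r) k"
    using permute_list_nth[OF p k] by (simp add: swap_def)
  moreover have index: "Suc (Suc (k - 2)) = k" if "\<not> k \<le> Suc r" using that by arith
  ultimately show "swap r is ! k = (take r is @ is ! Suc r # is ! r # drop (Suc (Suc r)) is) ! k"
    using assms k index by (auto simp: transpose_def nth_append nth_Cons' min_def Suc_diff_le)
qed

lemma split_at:
  assumes "Suc r < length is"
  shows "is = take r is @ is ! r # is ! Suc r # drop (Suc (Suc r)) is"
  using assms by (simp add: Cons_nth_drop_Suc)

text \<open>Parities are to be rearranged as in an abelian group, not rewritten to Boolean
  operations.\<close>

declare add_bit_eq_xor [simp del] mult_bit_eq_and [simp del]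

context spin_quiver
begin

text \<open>For odd \<open>i\<close> the Cartan integers are even. For even \<open>i\<close> the lcm
  of the two orbit sizes is even, and by \<open>d_sum\<close> the form is minus that lcm times the
  number of edge orbits.\<close>

lemma even_form:
  assumes "i \<in> I" "j \<in> I"
  shows "even (form i j)"
proof (cases "i = j")
  case False
  show ?thesis
  proof (cases "par i = 1")
    case True
    then obtain k :: int where "cartan i j = of_int (2 * k)"
      using cartan_even assms by blast
    then have "(of_int (form i j) :: rat) = of_int (2 * k * int (orb_size i))"
      using orb_size_pos[OF assms(1)] by (simp add: cartan_def field_simps)
    then have "form i j = 2 * k * int (orb_size i)" by (simp only: of_int_eq_iff)
    then show ?thesis by simp
  next
    case par: False
    then have "even (lcm (orb_size i) (orb_size j))"
      by (auto simp: par_def split: if_splits)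
    moreover define D L where "D = int (d_num i j + d_num j i)" and "L = int (lcm (orb_size i) (orb_size j))"
    have m: "m_lcm i j = 2 * L"
      by (simp add: L_def m_lcm_def form_def lcm_mult_left flip: of_nat_mult)
    have "2 * (D * L) = - 2 * form i j"
      using d_sum[OF assms False] unfolding m D_def[symmetric] by (simp only: mult.left_commute)
    then have "form i j = - (D * L)" by linarith
    ultimately show ?thesis by (simp add: L_def)
  qed
qed (simp add: form_def)

lemma form_commute: "form i j = form j i"
proof -
  have "{h \<in> arcs \<Gamma>. tail \<Gamma> h \<in> orbit aV i \<and> head \<Gamma> h \<in> orbit aV j \<or>
      tail \<Gamma> h \<in> orbit aV j \<and> head \<Gamma> h \<in> orbit aV i}
    = {h \<in> arcs \<Gamma>. tail \<Gamma> h \<in> orbit aV j \<and> head \<Gamma> h \<in> orbit aV i \<or>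
      tail \<Gamma> h \<in> orbit aV i \<and> head \<Gamma> h \<in> orbit aV j}" by blast
  then show ?thesis by (simp add: form_def)
qed

text \<open>The defect between the parity of a crossing and half of its degree.\<close>

definition twist :: "'a \<Rightarrow> 'a \<Rightarrow> bit" where
  "twist i j = of_nat (par i * par j) + of_int (form i j div 2)"

lemma of_nat_bit: "of_nat n = (of_bool (odd n) :: bit)"
  by (induction n) auto

text \<open>\<open>form i i div 2\<close> is the orbit size, whose residue mod 2 is the parity of
  \<open>i\<close>.\<close>

lemma twist_same: "twist i i = 0"
  by (simp add: twist_def form_def par_def of_nat_bit)

lemma twist_commute: "twist i j = twist j i"
  by (simp add: twist_def form_commute[of i j] mult.commute)

text \<open>The map \<open>h\<close> stands for an auxiliary total order: it is injective in all uses.\<close>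

primrec inversion_twist :: "('a \<Rightarrow> nat) \<Rightarrow> 'a list \<Rightarrow> bit" where
  "inversion_twist h [] = 0"
| "inversion_twist h (i # is) =
     (\<Sum>j\<in>#mset is. if h j < h i then twist i j else 0) + inversion_twist h is"

text \<open>Of the two orders of distinct neighbours exactly one is an inversion, so the exchange
  adds or removes a single term, which is the same thing in \<open>bit\<close>. Equal neighbours
  have defect zero.\<close>

lemma inversion_twist_swap:
  assumes "Suc r < length is" "inj_on h (set is)"
  shows "inversion_twist h (swap r is) = inversion_twist h is + twist (is ! r) (is ! Suc r)"
proof -
  have "inversion_twist h (u @ j # i # v) = inversion_twist h (u @ i # j # v) + twist i j"
    if inj: "inj_on h {i, j}" for u v i j
  proof (induction u)
    case Nil
    have eq: "i = j" if "h i = h j"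
      using inj_onD[OF inj that] by blast
    consider "h i < h j" | "h j < h i" | "i = j" using eq by (meson linorder_neqE_nat)
    then show ?case
      by cases (simp_all add: twist_same twist_commute[of j i] add_ac)
  next
    \<comment> \<open>The tail enters the sum only as a multiset, so a letter in front of the pair
      does not notice the exchange.\<close>
    case (Cons k u)
    then show ?case by (simp add: add_ac)
  qed
  note transpose = this
  have "is ! r \<in> set is" "is ! Suc r \<in> set is" using assms(1) by auto
  then have "inj_on h {is ! r, is ! Suc r}" by (intro inj_on_subset[OF assms(2)]) simp
  from transpose[OF this, of "take r is" "drop (Suc (Suc r)) is"]
  show ?thesis
    unfolding swap_eq[OF assms(1)] split_at[OF assms(1), symmetric] .
qed

lemma swap_permutations_of_multiset:
  assumes "is \<in> permutations_of_multiset \<nu>" "Suc r < size \<nu>"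
  shows "swap r is \<in> permutations_of_multiset \<nu>"
proof -
  have "length is = size \<nu>" using assms by (auto simp: permutations_of_multiset_def)
  then have "transpose r (Suc r) permutes {..<length is}"
    using assms by (auto intro: permutes_swap_id)
  then show ?thesis
    using assms by (simp add: swap_def permutations_of_multiset_def)
qed

end

section \<open>Weights and parities in a simple module\<close>

locale spin_simple_module = spin_quiver \<Gamma> aV aE I
  for \<Gamma> :: "('v, 'h) pre_digraph" and aV :: "'v \<Rightarrow> 'v" and aE :: "'h \<Rightarrow> 'h" and I :: "'v set" +
  fixes \<nu> :: "'v multiset" and M :: "(('v, 'k::field) spin_free set, 'm) module"
    and Md :: "int \<times> bit \<Rightarrow> 'm set"
  assumes support: "set_mset \<nu> \<subseteq> I"
    and simple: "graded_simple (spin_algebra \<nu>) (spin_component \<nu>) M Md"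
begin

abbreviation F :: "('v, 'k) spin_free ring" where "F \<equiv> free_algebra (generators \<nu>)"
abbreviation H :: "('v, 'k) spin_free set ring" where "H \<equiv> spin_algebra \<nu>"
abbreviation Hd :: "int \<times> bit \<Rightarrow> ('v, 'k) spin_free set set" where "Hd \<equiv> spin_component \<nu>"
abbreviation seqs :: "'v list set" where "seqs \<equiv> permutations_of_multiset \<nu>"

section \<open>The quotient map from the free algebra\<close>

definition proj :: "('v, 'k) spin_free \<Rightarrow> ('v, 'k) spin_free set" where
  "proj x = relation_ideal \<nu> +>\<^bsub>F\<^esub> x"

lemma seqs_length: "is \<in> seqs \<Longrightarrow> length is = size \<nu>"
  by (auto simp: permutations_of_multiset_def)

lemma seqs_nth:
  assumes "is \<in> seqs" "r < size \<nu>"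
  shows "is ! r \<in> I"
proof -
  have "is ! r \<in> set is" using assms by (simp add: seqs_length)
  also have "set is = set_mset \<nu>" using permutations_of_multisetD[OF assms(1)] by auto
  finally show ?thesis using support by blast
qed

lemma gE_closed: "is \<in> seqs \<Longrightarrow> gE is \<in> carrier F"
  by (simp add: free_algebra_closed generators_def)

lemma gY_closed: "r < size \<nu> \<Longrightarrow> gY r \<in> carrier F"
  by (auto simp: free_algebra_closed generators_def)

lemma gT_closed: "Suc r < size \<nu> \<Longrightarrow> gT r \<in> carrier F"
  by (auto simp: free_algebra_closed generators_def)

lemmas F_closed = gE_closed gY_closed gT_closed free_algebra_closed(2-)
  free_algebra_closed_power free_algebra_closed_sum

lemma relation_ideal: "ideal (relation_ideal \<nu>) F"
  unfolding relation_ideal_def by (rule ring.genideal_ideal[OF ring_free_algebra relators_closed])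

lemma proj_hom: "proj \<in> ring_hom F H"
proof -
  have "(+>\<^bsub>F\<^esub>) (relation_ideal \<nu>) = proj" by (simp add: proj_def fun_eq_iff)
  then show ?thesis
    using ideal.rcos_ring_hom[OF relation_ideal] by (simp add: spin_algebra_def)
qed

lemma proj_closed: "x \<in> carrier F \<Longrightarrow> proj x \<in> carrier H"
  by (rule ring_hom_closed[OF proj_hom])

lemma proj_add: "x \<in> carrier F \<Longrightarrow> y \<in> carrier F \<Longrightarrow> proj (x + y) = proj x \<oplus>\<^bsub>H\<^esub> proj y"
  using ring_hom_add[OF proj_hom] by simp

lemma proj_mult: "x \<in> carrier F \<Longrightarrow> y \<in> carrier F \<Longrightarrow> proj (x * y) = proj x \<otimes>\<^bsub>H\<^esub> proj y"
  using ring_hom_mult[OF proj_hom] by simp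

lemma proj_one: "proj 1 = \<one>\<^bsub>H\<^esub>"
  using ring_hom_one[OF proj_hom] by simp

lemma proj_zero: "proj 0 = \<zero>\<^bsub>H\<^esub>"
  using ring_hom_zero[OF proj_hom ring_free_algebra ring_spin_algebra] by simp

lemma carrier_H: "carrier H = proj ` carrier F"
  by (auto simp: spin_algebra_def FactRing_def A_RCOSETS_def' proj_def)

lemma a_inv_F: "x \<in> carrier F \<Longrightarrow> \<ominus>\<^bsub>F\<^esub> x = - x"
proof -
  interpret F: ring F by (rule ring_free_algebra)
  assume "x \<in> carrier F"
  then show ?thesis
    by (intro F.minus_equality) (simp_all add: free_algebra_closed)
qed

lemma proj_cong:
  assumes "x - y \<in> relators \<nu>" "x \<in> carrier F" "y \<in> carrier F"
  shows "proj x = proj y"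
proof -
  interpret F: ring F by (rule ring_free_algebra)
  have "x - y \<in> relation_ideal \<nu>"
    unfolding relation_ideal_def using F.genideal_self[OF relators_closed] assms(1) by blast
  moreover have "x \<ominus>\<^bsub>F\<^esub> y = x - y"
    using assms by (simp add: a_minus_def a_inv_F)
  ultimately show ?thesis
    using F.quotient_eq_iff_same_a_r_cos[OF relation_ideal assms(2,3)] by (simp add: proj_def)
qed

lemma proj_minus: "x \<in> carrier F \<Longrightarrow> proj (- x) = \<ominus>\<^bsub>H\<^esub> proj x"
proof -
  interpret h: ring_hom_ring F H proj
    by (rule ring_hom_ringI2[OF ring_free_algebra ring_spin_algebra proj_hom])
  assume "x \<in> carrier F"
  then show ?thesis using h.hom_a_inv[of x] by (simp add: a_inv_F)
qed

lemma proj_one_sum: "proj 1 = proj (\<Sum>is\<in>seqs. gE is)"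
  by (rule proj_cong[symmetric]) (auto simp: relators_def Let_def intro!: F_closed)

lemma homogeneous_closed: "homogeneous \<nu> c x \<Longrightarrow> x \<in> carrier F"
  by (induction rule: homogeneous.induct) (auto intro: F_closed)

lemma homogeneous_sum:
  "(\<And>i. i \<in> A \<Longrightarrow> homogeneous \<nu> c (f i)) \<Longrightarrow> homogeneous \<nu> c (\<Sum>i\<in>A. f i)"
  by (induction A rule: infinite_finite_induct) (auto intro: homogeneous.zero homogeneous.add)

lemma component_eq: "Hd c = proj ` {x. homogeneous \<nu> c x}"
  by (simp add: spin_component_def proj_def)

lemma component_carrier: "Hd c \<subseteq> carrier H"
  unfolding component_eq using homogeneous_closed proj_closed by blast

lemma component_zero_H: "\<zero>\<^bsub>H\<^esub> \<in> Hd c"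
  unfolding component_eq proj_zero[symmetric] by (auto intro: homogeneous.zero)

lemma component_add_H: "r \<in> Hd c \<Longrightarrow> s \<in> Hd c \<Longrightarrow> r \<oplus>\<^bsub>H\<^esub> s \<in> Hd c"
  unfolding component_eq
  by (auto simp: homogeneous_closed simp flip: proj_add intro: homogeneous.add)

lemma component_minus_H: "r \<in> Hd c \<Longrightarrow> \<ominus>\<^bsub>H\<^esub> r \<in> Hd c"
proof -
  have "- x = scalar (- 1) * x" for x :: "('v, 'k) spin_free"
    by (metis mult_minus1 scalar_def single_one single_uminus)
  then show "r \<in> Hd c \<Longrightarrow> \<ominus>\<^bsub>H\<^esub> r \<in> Hd c"
    unfolding component_eq
    by (auto simp: homogeneous_closed simp flip: proj_minus intro!: homogeneous.scale imageI)
qed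

lemma component_mult_H: "r \<in> Hd c \<Longrightarrow> s \<in> Hd c' \<Longrightarrow> r \<otimes>\<^bsub>H\<^esub> s \<in> Hd (c + c')"
  unfolding component_eq
  by (auto simp: homogeneous_closed simp flip: proj_mult intro: homogeneous.mult)

lemma component_one_H: "\<one>\<^bsub>H\<^esub> \<in> Hd 0"
proof -
  have "homogeneous \<nu> (0, 0) (\<Sum>is\<in>seqs. gE is :: ('v, 'k) spin_free)"
    by (intro homogeneous_sum homogeneous.idem)
  then show ?thesis
    unfolding component_eq proj_one[symmetric] proj_one_sum zero_prod_def by blast
qed

text \<open>Since \<open>y\<^sub>r\<close>, \<open>\<tau>\<^sub>r\<close> and the scalars are not homogeneous before passing to the quotient,
  the span is only compared modulo the relations.\<close>

lemma component_span:
  assumes a: "a \<in> carrier H" and hom: "\<And>c r. r \<in> Hd c \<Longrightarrow> r \<in> A"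
    and add: "\<And>r s. r \<in> carrier H \<Longrightarrow> s \<in> carrier H \<Longrightarrow> r \<in> A \<Longrightarrow> s \<in> A \<Longrightarrow> r \<oplus>\<^bsub>H\<^esub> s \<in> A"
  shows "a \<in> A"
proof -
  define B where "B = {x :: ('v, 'k) spin_free. \<exists>c. homogeneous \<nu> c x}"
  define S where "S = {sum_list xs | xs. set xs \<subseteq> B}"
  have SI: "x \<in> S" if "homogeneous \<nu> c x" for c x
  proof -
    have "set [x] \<subseteq> B" using that unfolding B_def by (simp del: split_paired_Ex) blast
    then show ?thesis unfolding S_def by (intro CollectI exI[of _ "[x]"]) simp
  qed
  have S_add: "x + y \<in> S" if xy: "x \<in> S" "y \<in> S" for x y
  proof -
    obtain xs ys where "x = sum_list xs" "y = sum_list ys"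
      "set xs \<subseteq> B" "set ys \<subseteq> B"
      using xy by (auto simp: S_def)
    then show ?thesis unfolding S_def by (intro CollectI exI[of _ "xs @ ys"]) simp
  qed
  have S_induct [consumes 1, case_names hom add]: "P x" if x: "x \<in> S" and P: "\<And>c x. homogeneous \<nu> c x \<Longrightarrow> P x"
    "\<And>x y. x \<in> S \<Longrightarrow> y \<in> S \<Longrightarrow> P x \<Longrightarrow> P y \<Longrightarrow> P (x + y)" for P x
  proof -
    obtain xs where x: "x = sum_list xs" and xs: "set xs \<subseteq> B"
      using x by (auto simp: S_def)
    have "P (sum_list xs) \<and> sum_list xs \<in> S" using xs
    proof (induction xs)
      case Nil
      show ?case using P(1)[OF homogeneous.zero] SI[OF homogeneous.zero] by simp
    next
      case (Cons y ys)
      then obtain c where "homogeneous \<nu> c y" by (auto simp: B_def)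
      then have "P y" "y \<in> S" using P(1) SI by auto
      then show ?case using Cons P(2) S_add by simp
    qed
    then show ?thesis by (simp add: x)
  qed
  have S_closed: "x \<in> carrier F" if "x \<in> S" for x
    using that by (induction rule: S_induct) (simp_all add: homogeneous_closed free_algebra_closed)
  have S_mult: "x * y \<in> S" if "x \<in> S" "y \<in> S" for x y
    using that(1)
  proof (induction rule: S_induct)
    case (hom c x)
    from that(2) show ?case
    proof (induction rule: S_induct)
      case (hom c' y)
      then show ?case by (intro SI[OF homogeneous.mult[OF \<open>homogeneous \<nu> c x\<close>]])
    next
      case (add y y')
      then show ?case using S_add by (simp add: distrib_left)
    qed
  next
    case (add x x')
    then show ?case using S_add by (simp add: distrib_right)
  qed
  have S_sum: "sum f K \<in> S" if "\<And>i. i \<in> K \<Longrightarrow> f i \<in> S" for f :: "'v list \<Rightarrow> _" and K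
    using that by (induction K rule: infinite_finite_induct) (auto intro: S_add SI homogeneous.zero)
  \<comment> \<open>Inserting the sum of all idempotents on the right replaces a generator by a sum
    of homogeneous elements of the same class.\<close>
  have right: "\<exists>y \<in> S. proj x = proj y"
    if "x \<in> carrier F" "\<And>is. is \<in> seqs \<Longrightarrow> x * gE is \<in> S" for x
  proof
    have "proj x = proj (x * 1)" by simp
    also have "\<dots> = proj (x * (\<Sum>is\<in>seqs. gE is))"
      using that(1) by (simp only: proj_mult proj_one_sum F_closed)
    finally show "proj x = proj (\<Sum>is\<in>seqs. x * gE is)" by (simp only: sum_distrib_left)
    show "(\<Sum>is\<in>seqs. x * gE is) \<in> S" by (intro S_sum that(2))
  qed
  obtain f where f: "f \<in> carrier F" "a = proj f" using a by (auto simp: carrier_H)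
  have "\<exists>y \<in> S. proj f = proj y" using f(1)
  proof (induction f rule: free_algebra_induct)
    case (scalar c)
    show ?case by (rule right) (auto intro: F_closed SI homogeneous.scale homogeneous.idem)
  next
    case (letter g)
    then consider "is" where "is \<in> seqs" "g = E_gen is" | r where "r < size \<nu>" "g = Y_gen r"
      | r where "Suc r < size \<nu>" "g = T_gen r" by (auto simp: generators_def)
    then show ?case
    proof cases
      case 1
      then have "letter g \<in> S" using SI[OF homogeneous.idem[OF 1(1)]] by simp
      then show ?thesis by (intro bexI[of _ "letter g"] refl)
    next
      case 2
      then show ?thesis by (intro right) (auto intro: F_closed SI homogeneous.dot)
    next
      case 3
      then show ?thesis by (intro right) (auto intro: F_closed SI homogeneous.crossing)
    qed
  next
    case (add x y)
    then show ?case by (metis S_add S_closed proj_add)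
  next
    case (mult x y)
    then show ?case by (metis S_mult S_closed proj_mult)
  qed
  then obtain y where y: "y \<in> S" "a = proj y" using f(2) by auto
  have "proj y \<in> A" using y(1)
  proof (induction rule: S_induct)
    case (hom c x)
    then show ?case using assms(2)[of "proj x" c] by (auto simp: component_eq)
  next
    case (add x x')
    then show ?case using assms(3)[of "proj x" "proj x'"] by (simp add: S_closed proj_add proj_closed)
  qed
  then show ?thesis using y(2) by simp
qed

lemma spanned: "spanned_graded_left_module H Hd M Md"
proof (intro spanned_graded_left_module.intro graded_left_module.intro
    spanned_graded_left_module_axioms.intro)
  show "graded_module H Hd M Md" using simple by (simp add: graded_simple_def)
  show "Hd c \<subseteq> carrier H" for c by (rule component_carrier)
  fix a A assume a: "a \<in> carrier H" "\<And>c r. r \<in> Hd c \<Longrightarrow> r \<in> A"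
    "\<And>r s. r \<in> carrier H \<Longrightarrow> s \<in> carrier H \<Longrightarrow> r \<in> A \<Longrightarrow> s \<in> A \<Longrightarrow> r \<oplus>\<^bsub>H\<^esub> s \<in> A"
  show "a \<in> A" by (rule component_span[of a A, OF a])
qed

sublocale spanned_graded_left_module H Hd M Md
  by (rule spanned)

section \<open>The free algebra acting on the module\<close>

definition act :: "('v, 'k) spin_free \<Rightarrow> 'm \<Rightarrow> 'm" where
  "act f x = proj f \<odot>\<^bsub>M\<^esub> x"

lemma act_closed: "f \<in> carrier F \<Longrightarrow> x \<in> carrier M \<Longrightarrow> act f x \<in> carrier M"
  by (simp add: act_def proj_closed smult_closed)

lemma act_add_left:
  "f \<in> carrier F \<Longrightarrow> g \<in> carrier F \<Longrightarrow> x \<in> carrier M \<Longrightarrow> act (f + g) x = act f x \<oplus>\<^bsub>M\<^esub> act g x"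
  by (simp add: act_def proj_closed proj_add smult_l_distr)

lemma act_mult:
  "f \<in> carrier F \<Longrightarrow> g \<in> carrier F \<Longrightarrow> x \<in> carrier M \<Longrightarrow> act (f * g) x = act f (act g x)"
  by (simp add: act_def proj_closed proj_mult smult_assoc)

lemma act_one: "x \<in> carrier M \<Longrightarrow> act 1 x = x"
  by (simp add: act_def proj_one smult_one)

lemma act_zero_left: "x \<in> carrier M \<Longrightarrow> act 0 x = \<zero>\<^bsub>M\<^esub>"
  by (simp add: act_def proj_zero smult_zero_left)

lemma act_minus_left: "f \<in> carrier F \<Longrightarrow> x \<in> carrier M \<Longrightarrow> act (- f) x = \<ominus>\<^bsub>M\<^esub> act f x"
  by (simp add: act_def proj_closed proj_minus smult_minus_left)

lemma act_add_right:
  "f \<in> carrier F \<Longrightarrow> x \<in> carrier M \<Longrightarrow> y \<in> carrier M \<Longrightarrow> act f (x \<oplus>\<^bsub>M\<^esub> y) = act f x \<oplus>\<^bsub>M\<^esub> act f y"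
  by (simp add: act_def proj_closed smult_r_distr)

lemma act_zero_right: "f \<in> carrier F \<Longrightarrow> act f \<zero>\<^bsub>M\<^esub> = \<zero>\<^bsub>M\<^esub>"
  by (simp add: act_def proj_closed smult_zero_right)

lemma act_minus_right: "f \<in> carrier F \<Longrightarrow> x \<in> carrier M \<Longrightarrow> act f (\<ominus>\<^bsub>M\<^esub> x) = \<ominus>\<^bsub>M\<^esub> act f x"
  by (simp add: act_def proj_closed smult_minus_right)

text \<open>Relators are literal differences in the free algebra, so each defining relation becomes
  an equality of operators on \<open>M\<close>.\<close>

lemma act_cong:
  "f - g \<in> relators \<nu> \<Longrightarrow> f \<in> carrier F \<Longrightarrow> g \<in> carrier F \<Longrightarrow> act f x = act g x"
  using proj_cong[of f g] by (simp add: act_def)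

lemma act_sum:
  assumes "\<And>i. i \<in> A \<Longrightarrow> f i \<in> carrier F" "x \<in> carrier M" "finite A"
  shows "act (\<Sum>i\<in>A. f i) x = finsum M (\<lambda>i. act (f i) x) A"
  using assms(3,1)
proof (induction A rule: finite_induct)
  case empty
  then show ?case using assms(2) by (simp add: act_zero_left)
next
  case (insert i A)
  then have "sum f A \<in> carrier F" by (auto intro: F_closed)
  then show ?case using insert assms(2) by (simp add: act_add_left act_closed Pi_def)
qed

lemma act_E_sum:
  assumes "x \<in> carrier M"
  shows "finsum M (\<lambda>is. act (gE is) x) seqs = x"
proof -
  have "x = act (\<Sum>is\<in>seqs. gE is) x"
    using act_one[OF assms] by (simp add: act_def proj_one_sum)
  also have "\<dots> = finsum M (\<lambda>is. act (gE is) x) seqs"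
    by (rule act_sum) (use assms gE_closed in auto)
  finally show ?thesis by simp
qed

lemma act_E_E:
  assumes "is \<in> seqs" "js \<in> seqs" "x \<in> carrier M"
  shows "act (gE js) (act (gE is) x) = (if js = is then act (gE is) x else \<zero>\<^bsub>M\<^esub>)"
proof -
  have "gE js * gE is - (if js = is then gE js else 0) \<in> relators \<nu>"
    unfolding relators_def Let_def using assms by blast
  from act_cong[OF this, of x]
  have "act (gE js * gE is) x = act (if js = is then gE js else 0) x"
    using assms by (auto simp: F_closed)
  then show ?thesis using assms by (simp add: act_mult gE_closed act_zero_left)
qed

lemma act_E_Y:
  assumes "js \<in> seqs" "r < size \<nu>" "x \<in> carrier M"
  shows "act (gE js) (act (gY r) x) = act (gY r) (act (gE js) x)"
proof -
  have "gY r * gE js - gE js * gY r \<in> relators \<nu>"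
    unfolding relators_def Let_def using assms by blast
  from act_cong[OF this, of x] show ?thesis
    using assms by (simp add: F_closed act_mult)
qed

text \<open>A crossing carries the weight \<open>is\<close> to the weight \<open>swap r is\<close>:
  the relation turns the idempotent on its right into one on its left, and orthogonality decides the
  rest.\<close>

lemma act_E_T:
  assumes "js \<in> seqs" "is \<in> seqs" "Suc r < size \<nu>" "x \<in> carrier M"
  shows "act (gE js) (act (gT r) (act (gE is) x)) =
    (if js = swap r is then act (gT r) (act (gE is) x) else \<zero>\<^bsub>M\<^esub>)"
proof -
  have sw: "swap r is \<in> seqs" by (rule swap_permutations_of_multiset) (use assms in auto)
  have "gT r * gE is - gE (swap r is) * gT r \<in> relators \<nu>"
    unfolding relators_def Let_def using assms by blast
  from act_cong[OF this, of x]
  have T: "act (gT r) (act (gE is) x) = act (gE (swap r is)) (act (gT r) x)"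
    using assms sw by (simp add: F_closed act_mult)
  show ?thesis
    unfolding T using act_E_E[OF sw assms(1), of "act (gT r) x"] assms by (simp add: act_closed gT_closed)
qed

lemma act_homogeneous:
  "homogeneous \<nu> c f \<Longrightarrow> x \<in> Md d \<Longrightarrow> act f x \<in> Md (c + d)"
  unfolding act_def by (rule smult_Md) (auto simp: component_eq)

lemma component_act:
  "homogeneous \<nu> c f \<Longrightarrow> x \<in> carrier M \<Longrightarrow> component (act f x) d = act f (component x (d - c))"
  unfolding act_def by (rule component_smult) (auto simp: component_eq)

section \<open>The parity expected from degree and weight\<close>

definition seq_order :: "'v \<Rightarrow> nat" where
  "seq_order = (SOME h. inj_on h (set_mset \<nu>))"

lemma inj_seq_order: "inj_on seq_order (set_mset \<nu>)"
proof -
  obtain h :: "'v \<Rightarrow> nat" where "inj_on h (set_mset \<nu>)"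
    using finite_imp_inj_to_nat_seg[OF finite_set_mset[of \<nu>]] by blast
  then show ?thesis unfolding seq_order_def by (rule someI[where P = "\<lambda>h. inj_on h (set_mset \<nu>)"])
qed

text \<open>Half of the degree plus the integrated defect. Another order of the colours would change
  it by a constant depending on \<open>\<nu>\<close> alone.\<close>

definition expected_parity :: "int \<Rightarrow> 'v list \<Rightarrow> bit" where
  "expected_parity c is = of_int (c div 2) + inversion_twist seq_order is"

lemma expected_parity_add:
  "even c' \<Longrightarrow> expected_parity (c' + c) is = of_int (c' div 2) + expected_parity c is"
  by (auto simp: expected_parity_def add_ac elim!: evenE)

text \<open>Half of the degree of the crossing and the form in the defect cancel, which leaves the
  product of the two colour parities, the parity of the crossing itself.\<close>

lemma expected_parity_swap:
  assumes "is \<in> seqs" "Suc r < size \<nu>"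
  shows "expected_parity (- form (is ! r) (is ! Suc r) + c) (swap r is) =
    of_nat (par (is ! r) * par (is ! Suc r)) + expected_parity c is"
proof -
  define g where "g = form (is ! r) (is ! Suc r) div 2"
  have "even (form (is ! r) (is ! Suc r))"
    by (rule even_form) (use assms seqs_nth in auto)
  then have ev: "even (form (is ! r) (is ! Suc r))" "even (- form (is ! r) (is ! Suc r))"
    by simp_all
  have h: "- form (is ! r) (is ! Suc r) div 2 = - g"
    unfolding g_def using ev(1) by (auto elim!: evenE)
  have "set is = set_mset \<nu>" using permutations_of_multisetD[OF assms(1)] by auto
  then have inv: "inversion_twist seq_order (swap r is) =
      inversion_twist seq_order is + (of_nat (par (is ! r) * par (is ! Suc r)) + of_int g)"
    using inversion_twist_swap[of r "is" seq_order] assms inj_seq_order seqs_length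
    by (simp only: twist_def g_def)
  have "expected_parity (- form (is ! r) (is ! Suc r) + c) (swap r is) =
      of_int (- g) + expected_parity c (swap r is)"
    by (simp only: expected_parity_add[OF ev(2)] h)
  also have "\<dots> = of_int (- g) + of_int g +
      (of_nat (par (is ! r) * par (is ! Suc r)) + expected_parity c is)"
    by (simp only: expected_parity_def inv ac_simps)
  also have "of_int (- g) + of_int g = (0 :: bit)" by (simp only: of_int_minus left_minus)
  finally show ?thesis by (simp only: add_0_left)
qed

text \<open>\<open>t\<close> is a global parity shift. A member may mix several weights, provided
  that all weights present in it expect the parity of its bidegree.\<close>

definition pure_part :: "bit \<Rightarrow> int \<times> bit \<Rightarrow> 'm set" where
  "pure_part t d = {x \<in> Md d. \<forall>is \<in> seqs. snd d \<noteq> expected_parity (fst d) is + t \<longrightarrow> act (gE is) x = \<zero>\<^bsub>M\<^esub>}"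

lemma pure_part_carrier: "x \<in> pure_part t d \<Longrightarrow> x \<in> carrier M"
  unfolding pure_part_def using Md_closed(1) by blast

text \<open>Each generator changes the actual and the expected parity by the same amount: dots keep
  the weight, crossings exchange two neighbours.\<close>

lemma pure_part_homogeneous:
  assumes "homogeneous \<nu> c f" "x \<in> pure_part t d"
  shows "act f x \<in> pure_part t (c + d)"
  using assms
proof (induction arbitrary: x d rule: homogeneous.induct)
  case (idem "is")
  have "x \<in> carrier M" by (rule pure_part_carrier) (rule idem)
  moreover have "act (gE is) x \<in> Md d"
    using act_homogeneous[OF homogeneous.idem[OF idem(1)], of x d] idem
    by (auto simp: pure_part_def zero_prod_def[symmetric])
  ultimately show ?case
    using idem act_E_E[OF idem(1)] by (auto simp: pure_part_def zero_prod_def[symmetric])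
next
  case (dot "is" r)
  let ?a = "form (is ! r) (is ! r)"
  have x: "x \<in> carrier M" by (rule pure_part_carrier) (rule dot)
  \<comment> \<open>Half of the degree of a dot is the orbit size, congruent to its parity mod
    2.\<close>
  have a: "even ?a" "of_int (?a div 2) = (of_nat (par (is ! r)) :: bit)"
    by (simp_all add: form_def par_def of_nat_bit)
  have mem: "act (gY r * gE is) x \<in> Md ((?a, of_nat (par (is ! r))) + d)"
    using dot by (intro act_homogeneous homogeneous.dot) (auto simp: pure_part_def)
  have "act (gE js) (act (gY r * gE is) x) = \<zero>\<^bsub>M\<^esub>"
    if js: "js \<in> seqs" and ne: "of_nat (par (is ! r)) + snd d \<noteq> expected_parity (?a + fst d) js + t" for js
  proof -
    have "act (gE js) (act (gY r * gE is) x) = act (gY r) (act (gE js) (act (gE is) x))"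
      using dot x js by (simp add: act_mult F_closed act_closed act_E_Y)
    moreover have "snd d \<noteq> expected_parity (fst d) js + t"
      using ne by (simp add: expected_parity_add[OF a(1)] a(2) add.assoc)
    then have "act (gE js) x = \<zero>\<^bsub>M\<^esub>" using dot js by (auto simp: pure_part_def)
    ultimately show ?thesis
      using dot x js act_E_E[OF dot(1) js x] by (auto simp: act_zero_right gY_closed)
  qed
  with mem show ?case by (simp add: pure_part_def)
next
  case (crossing "is" r)
  let ?a = "- form (is ! r) (is ! Suc r)" and ?p = "of_nat (par (is ! r) * par (is ! Suc r)) :: bit"
  have x: "x \<in> carrier M" by (rule pure_part_carrier) (rule crossing)
  have mem: "act (gT r * gE is) x \<in> Md ((?a, ?p) + d)"
    using crossing by (intro act_homogeneous homogeneous.crossing) (auto simp: pure_part_def)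
  have "act (gE js) (act (gT r * gE is) x) = \<zero>\<^bsub>M\<^esub>"
    if js: "js \<in> seqs" and ne: "?p + snd d \<noteq> expected_parity (?a + fst d) js + t" for js
  proof (cases "js = swap r is")
    \<comment> \<open>The crossing shifts both parities alike, so a mismatch at
      \<open>swap r is\<close> after it is a mismatch at \<open>is\<close> before it.\<close>
    case True
    then have "snd d \<noteq> expected_parity (fst d) is + t"
      using ne unfolding True expected_parity_swap[OF crossing(1,2)] by (simp only: add.assoc add_left_cancel not_False_eq_True)
    then have "act (gE is) x = \<zero>\<^bsub>M\<^esub>" using crossing by (auto simp: pure_part_def)
    then show ?thesis
      using crossing x js by (simp add: act_mult F_closed act_zero_right)
  next
    case False
    then show ?thesis
      using crossing x js by (simp add: act_mult F_closed act_E_T)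
  qed
  with mem show ?case by (simp add: pure_part_def)
next
  case (mult c y c' z)
  have "x \<in> carrier M" by (rule pure_part_carrier) (rule mult.prems)
  then have "act (y * z) x = act y (act z x)"
    using mult.hyps homogeneous_closed by (intro act_mult)
  then show ?case using mult.IH(1)[OF mult.IH(2)[OF mult.prems]] by (simp add: add.assoc)
next
  case (zero c)
  have "x \<in> carrier M" by (rule pure_part_carrier) (rule zero)
  then show ?case
    by (auto simp: act_zero_left act_zero_right pure_part_def Md_closed gE_closed)
next
  case (add c y z)
  have x: "x \<in> carrier M" by (rule pure_part_carrier) (rule add.prems)
  have yz: "y \<in> carrier F" "z \<in> carrier F" using add.hyps homogeneous_closed by auto
  have "act y x \<in> pure_part t (c + d)" "act z x \<in> pure_part t (c + d)"
    using add.IH add.prems by auto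
  then show ?case
    unfolding act_add_left[OF yz x] pure_part_def
    by (auto simp: Md_closed act_add_right gE_closed act_closed yz x)
next
  case (scale c y b)
  have x: "x \<in> carrier M" by (rule pure_part_carrier) (rule scale.prems)
  have y: "y \<in> carrier F" using scale.hyps homogeneous_closed by auto
  have IH: "act y x \<in> pure_part t (c + d)" using scale by auto
  have "act (gE js) (act (scalar b * y) x) = act (scalar b) (act (gE js) (act y x))" if "js \<in> seqs" for js
  proof -
    have "gE js * (scalar b * y) = scalar b * (gE js * y)"
      by (metis mult.assoc scalar_commute)
    then have "act (gE js * (scalar b * y)) x = act (scalar b * (gE js * y)) x" by simp
    then show ?thesis using that x y by (simp add: act_mult act_closed F_closed)
  qed
  moreover have "act (scalar b * y) x \<in> Md (c + d)"
    using scale.prems scale.hyps by (intro act_homogeneous homogeneous.scale) (auto simp: pure_part_def)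
  ultimately show ?case
    using IH by (auto simp: pure_part_def act_zero_right F_closed)
qed

end

section \<open>Boundedness of the degrees\<close>

context spin_simple_module
begin

section \<open>Subgroups of the module and operators between them\<close>

abbreviation additive :: "'m set \<Rightarrow> bool" where
  "additive U \<equiv> subgroup U (add_monoid M)"

text \<open>Scalars are listed along with idempotents and dots because \<open>M\<close> is given as
  a module over a ring, so a subgroup need not be a subspace.\<close>

definition polynomial_stable :: "'m set \<Rightarrow> bool" where
  "polynomial_stable U \<longleftrightarrow> additive U \<and> (\<forall>x \<in> U.
     (\<forall>b. act (scalar b) x \<in> U) \<and> (\<forall>is \<in> seqs. act (gE is) x \<in> U) \<and> (\<forall>r < size \<nu>. act (gY r) x \<in> U))"

text \<open>Sums, signs and composites of such operators are again of this kind, so stability can be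
  followed through the terms of a relator without naming vectors.\<close>

definition transporter :: "'m set \<Rightarrow> 'm set \<Rightarrow> ('v, 'k) spin_free set" where
  "transporter U Z = {f \<in> carrier F. \<forall>x \<in> U. act f x \<in> Z}"

lemma additive_finsum:
  assumes "additive U" "\<And>i. i \<in> A \<Longrightarrow> f i \<in> U"
  shows "finsum M f A \<in> U"
  using assms(2)
proof (induction A rule: infinite_finite_induct)
  case (insert i A)
  moreover from this have "f \<in> A \<rightarrow> carrier M" "f i \<in> carrier M"
    using additive_subgroupD(5)[OF assms(1)] by auto
  ultimately show ?case using additive_subgroupD(4)[OF assms(1)] by simp
qed (simp_all add: additive_subgroupD(2)[OF assms(1)])

lemma transporterD: "f \<in> transporter U Z \<Longrightarrow> x \<in> U \<Longrightarrow> act f x \<in> Z"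
  "f \<in> transporter U Z \<Longrightarrow> f \<in> carrier F"
  by (auto simp: transporter_def)

lemma transporter_group:
  assumes "additive Z" "U \<subseteq> carrier M"
  shows "0 \<in> transporter U Z"
    and "f \<in> transporter U Z \<Longrightarrow> g \<in> transporter U Z \<Longrightarrow> f + g \<in> transporter U Z"
    and "f \<in> transporter U Z \<Longrightarrow> - f \<in> transporter U Z"
    and "f \<in> transporter U Z \<Longrightarrow> g \<in> transporter U Z \<Longrightarrow> f - g \<in> transporter U Z"
proof -
  note Z = additive_subgroupD[OF assms(1)]
  show "0 \<in> transporter U Z"
    using assms Z(2) by (auto simp: transporter_def act_zero_left F_closed)
  show add: "f + g \<in> transporter U Z" if "f \<in> transporter U Z" "g \<in> transporter U Z" for f g
    using that assms(2) Z(4) by (auto simp: transporter_def act_add_left F_closed subset_iff)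
  show minus: "- f \<in> transporter U Z" if "f \<in> transporter U Z" for f
    using that assms(2) Z(3) by (auto simp: transporter_def act_minus_left F_closed subset_iff)
  show "f - g \<in> transporter U Z" if "f \<in> transporter U Z" "g \<in> transporter U Z" for f g
    using add[OF that(1) minus[OF that(2)]] by simp
qed

lemma transporter_sign:
  assumes "additive Z" "U \<subseteq> carrier M"
  shows "(- 1) ^ n * f \<in> transporter U Z \<longleftrightarrow> f \<in> transporter U Z"
  using transporter_group(3)[OF assms, of f] transporter_group(3)[OF assms, of "- f"]
  by (cases "even n") auto

lemma transporter_cong:
  assumes "f - g \<in> relators \<nu>" "f \<in> carrier F" "g \<in> carrier F"
  shows "f \<in> transporter U Z \<longleftrightarrow> g \<in> transporter U Z"
  using act_cong[OF assms] assms(2,3) by (simp add: transporter_def)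

lemma transporter_mult:
  assumes "U \<subseteq> carrier M" "f \<in> transporter Y Z" "g \<in> transporter U Y"
  shows "f * g \<in> transporter U Z"
  using assms by (auto simp: transporter_def act_mult F_closed subset_iff)

lemma transporter_sets:
  assumes "f \<in> transporter U Y" "U' \<subseteq> U" "Y \<subseteq> Y'"
  shows "f \<in> transporter U' Y'"
  using assms by (auto simp: transporter_def)

lemma transporter_one: "U \<subseteq> carrier M \<Longrightarrow> 1 \<in> transporter U U"
  by (auto simp: transporter_def act_one F_closed subset_iff)

lemma transporter_power:
  "U \<subseteq> carrier M \<Longrightarrow> f \<in> transporter U U \<Longrightarrow> f ^ n \<in> transporter U U"
  by (induction n) (simp_all add: transporter_one transporter_mult)

lemma transporter_sum:
  assumes "additive Z" "U \<subseteq> carrier M" "\<And>i. i \<in> A \<Longrightarrow> f i \<in> transporter U Z"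
  shows "sum f A \<in> transporter U Z"
  using assms(3) by (induction A rule: infinite_finite_induct) (auto intro: transporter_group[OF assms(1,2)])

lemma polynomial_stableD:
  assumes "polynomial_stable U"
  shows "additive U" "U \<subseteq> carrier M" "scalar b \<in> transporter U U"
    "is \<in> seqs \<Longrightarrow> gE is \<in> transporter U U" "r < size \<nu> \<Longrightarrow> gY r \<in> transporter U U"
  using assms additive_subgroupD(1)[of U] by (simp_all add: polynomial_stable_def transporter_def F_closed)

lemma polynomial_stable_Q_poly:
  assumes "polynomial_stable U" "u \<in> transporter U U" "v \<in> transporter U U"
  shows "Q_poly i j u v \<in> transporter U U"
proof -
  note U = polynomial_stableD(1,2)[OF assms(1)]
  note cl = assms(2-) transporter_group[OF U] transporter_one[OF U(2)] transporter_mult[OF U(2)]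
    transporter_power[OF U(2)]
  show ?thesis unfolding Q_poly_def by (auto intro!: cl)
qed

lemma polynomial_stable_Q_quot:
  assumes "polynomial_stable U" "u' \<in> transporter U U" "u \<in> transporter U U" "v \<in> transporter U U"
  shows "Q_quot0 i j u' u v \<in> transporter U U" "Q_quot1 i j u' u v \<in> transporter U U"
proof -
  note U = polynomial_stableD(1,2)[OF assms(1)]
  note cl = assms(2-) transporter_group[OF U] transporter_one[OF U(2)] transporter_mult[OF U(2)]
    transporter_power[OF U(2)] transporter_sum[OF U]
  show "Q_quot0 i j u' u v \<in> transporter U U"
    unfolding Q_quot0_def Let_def by (auto intro!: cl)
  show "Q_quot1 i j u' u v \<in> transporter U U"
    unfolding Q_quot1_def Let_def by (auto intro!: cl)
qed

text \<open>Most relations are available only after right multiplication by an idempotent. The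
  idempotents sum to the identity on \<open>M\<close>, so one weight at a time is enough.\<close>

lemma transporter_weightwise:
  assumes "additive Z" "U \<subseteq> carrier M" "f \<in> carrier F" "\<And>is. is \<in> seqs \<Longrightarrow> f * gE is \<in> transporter U Z"
  shows "f \<in> transporter U Z"
  unfolding transporter_def
proof (intro CollectI conjI ballI assms(3))
  fix x assume x: "x \<in> U"
  then have xc: "x \<in> carrier M" using assms(2) by blast
  have "act f x = act f (finsum M (\<lambda>is. act (gE is) x) seqs)"
    by (simp only: act_E_sum[OF xc])
  also have "\<dots> = finsum M (\<lambda>is. act f (act (gE is) x)) seqs"
    unfolding act_def[of f] by (rule smult_finsum)
      (use assms(3) xc in \<open>auto simp: proj_closed act_closed gE_closed\<close>)
  also have "\<dots> = finsum M (\<lambda>is. act (f * gE is) x) seqs"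
    by (rule M.finsum_cong') (use assms(3) xc in \<open>auto simp: act_mult act_closed gE_closed\<close>)
  also have "\<dots> \<in> Z"
    by (rule additive_finsum[OF assms(1)]) (use assms(4) x in \<open>auto simp: transporter_def\<close>)
  finally show "act f x \<in> Z" .
qed

text \<open>Adding the images under \<open>\<tau>\<^sub>k\<close> for \<open>k = m, \<dots>, 0\<close> in turn makes a polynomial-stable subgroup that is
  closed under \<open>\<tau>\<^sub>0, \<dots>, \<tau>\<^sub>m\<^sub>-\<^sub>1\<close> closed under \<open>\<tau>\<^sub>m\<close> as well. This replaces the spanning of the algebra by
  finitely many words in the \<open>\<tau>\<^sub>r\<close> over the polynomials.\<close>

definition step :: "nat \<Rightarrow> 'm set \<Rightarrow> 'm set" where
  "step k U = {x \<oplus>\<^bsub>M\<^esub> act (gT k) y | x y. x \<in> U \<and> y \<in> U}"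

text \<open>\<open>step k U\<close> is the sum of \<open>U\<close> and its image under
  \<open>gT k\<close>, so both conditions on \<open>f\<close> are conditions on
  \<open>U\<close>.\<close>

lemma transporter_step:
  assumes "additive Z" "U \<subseteq> carrier M" "Suc k < size \<nu>" "f \<in> transporter U Z" "f * gT k \<in> transporter U Z"
  shows "f \<in> transporter (step k U) Z"
  unfolding transporter_def
proof (intro CollectI conjI ballI)
  show f: "f \<in> carrier F" by (rule transporterD(2)[OF assms(4)])
  fix z assume "z \<in> step k U"
  then obtain x y where xy: "z = x \<oplus>\<^bsub>M\<^esub> act (gT k) y" "x \<in> U" "y \<in> U" by (auto simp: step_def)
  then have "x \<in> carrier M" "y \<in> carrier M" using assms(2) by auto
  then have "act f z = act f x \<oplus>\<^bsub>M\<^esub> act (f * gT k) y"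
    using f assms(3) by (simp add: xy(1) act_add_right act_mult act_closed gT_closed)
  then show "act f z \<in> Z"
    using additive_subgroupD(4)[OF assms(1)] transporterD(1)[OF assms(4)] transporterD(1)[OF assms(5)] xy(2,3)
    by simp
qed

lemma step_superset:
  assumes "additive U" "Suc k < size \<nu>"
  shows "U \<subseteq> step k U"
proof
  fix x assume "x \<in> U"
  moreover have "act (gT k) \<zero>\<^bsub>M\<^esub> = \<zero>\<^bsub>M\<^esub>" by (rule act_zero_right) (rule gT_closed, rule assms(2))
  ultimately show "x \<in> step k U"
    unfolding step_def using additive_subgroupD[OF assms(1)]
    by (intro CollectI exI[of _ x] exI[of _ "\<zero>\<^bsub>M\<^esub>"]) simp
qed

lemma transporter_T_step:
  assumes "additive U" "Suc k < size \<nu>"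
  shows "gT k \<in> transporter U (step k U)"
  unfolding transporter_def
proof (intro CollectI conjI ballI gT_closed assms(2))
  fix x assume x: "x \<in> U"
  then have "act (gT k) x \<in> carrier M"
    using assms additive_subgroupD(5) by (intro act_closed gT_closed) auto
  then show "act (gT k) x \<in> step k U"
    unfolding step_def using x additive_subgroupD(2)[OF assms(1)]
    by (intro CollectI exI[of _ "\<zero>\<^bsub>M\<^esub>"] exI[of _ x]) simp
qed

lemma additive_step:
  assumes "additive U" "Suc k < size \<nu>"
  shows "additive (step k U)"
proof (rule additive_subgroupI)
  note U = additive_subgroupD[OF assms(1)]
  have T: "act (gT k) x \<in> carrier M" if "x \<in> U" for x
    using that assms(2) U(5) by (intro act_closed gT_closed)
  show "step k U \<subseteq> carrier M" using T U(5) by (auto simp: step_def)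
  show "\<zero>\<^bsub>M\<^esub> \<in> step k U" using step_superset[OF assms] U(2) by blast
  show "\<ominus>\<^bsub>M\<^esub> x \<in> step k U" if x: "x \<in> step k U" for x
  proof -
    obtain y z where "x = y \<oplus>\<^bsub>M\<^esub> act (gT k) z" "y \<in> U" "z \<in> U" using x by (auto simp: step_def)
    then show ?thesis
      unfolding step_def using T U assms(2)
      by (intro CollectI exI[of _ "\<ominus>\<^bsub>M\<^esub> y"] exI[of _ "\<ominus>\<^bsub>M\<^esub> z"])
        (simp add: act_minus_right gT_closed M.minus_add)
  qed
  show "x \<oplus>\<^bsub>M\<^esub> x' \<in> step k U" if x: "x \<in> step k U" "x' \<in> step k U" for x x'
  proof -
    obtain y z where yz: "x = y \<oplus>\<^bsub>M\<^esub> act (gT k) z" "y \<in> U" "z \<in> U" using x(1) by (auto simp: step_def)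
    obtain y' z' where yz': "x' = y' \<oplus>\<^bsub>M\<^esub> act (gT k) z'" "y' \<in> U" "z' \<in> U" using x(2) by (auto simp: step_def)
    have "x \<oplus>\<^bsub>M\<^esub> x' = (y \<oplus>\<^bsub>M\<^esub> y') \<oplus>\<^bsub>M\<^esub> act (gT k) (z \<oplus>\<^bsub>M\<^esub> z')"
      using yz yz' T U(5) assms(2) by (simp add: act_add_right gT_closed M.a_ac)
    then show ?thesis unfolding step_def using yz yz' U(4) by blast
  qed
qed

text \<open>A dot passes a crossing at the price of a sign, a change of strand and, for equal
  colours, a correction that already preserves \<open>U\<close>.\<close>

lemma polynomial_stable_step:
  assumes U: "polynomial_stable U" and k: "Suc k < size \<nu>"
  shows "polynomial_stable (step k U)"
proof -
  note XD = polynomial_stableD[OF U]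
  let ?Z = "step k U"
  have Z: "additive ?Z" by (rule additive_step[OF XD(1) k])
  have XZ: "U \<subseteq> ?Z" by (rule step_superset[OF XD(1) k])
  have T: "gT k \<in> transporter U ?Z" by (rule transporter_T_step[OF XD(1) k])
  have into: "f \<in> transporter U ?Z" if "f \<in> transporter U U" for f
    by (rule transporter_sets[OF that _ XZ]) simp
  have T_into: "gT k * f \<in> transporter U ?Z" if "f \<in> transporter U U" for f
    by (rule transporter_mult[OF XD(2) T that])
  note tm = transporter_mult[OF XD(2)] and tg = transporter_group[OF Z XD(2)]
    and ts = transporter_sign[OF Z XD(2)]
  have "scalar b \<in> transporter ?Z ?Z" for b
    by (rule transporter_step[OF Z XD(2) k]) (use into T_into XD(3) in \<open>auto simp: scalar_commute\<close>)
  moreover have "gE js \<in> transporter ?Z ?Z" if js: "js \<in> seqs" for js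
  proof (rule transporter_step[OF Z XD(2) k])
    show "gE js \<in> transporter U ?Z" by (rule into) (rule XD(4)[OF js])
    show "gE js * gT k \<in> transporter U ?Z"
    proof (rule transporter_weightwise[OF Z XD(2)])
      show "gE js * gT k \<in> carrier F" using js k by (intro F_closed)
      fix "is" assume iseq: "is \<in> seqs"
      have "act (gE js * gT k * gE is) x = (if js = swap k is then act (gT k * gE is) x else \<zero>\<^bsub>M\<^esub>)"
        if "x \<in> U" for x
        using js iseq k XD(2) that by (simp add: mult.assoc act_mult act_E_T F_closed act_closed subset_iff)
      moreover have "gT k * gE is \<in> transporter U ?Z" by (rule T_into) (rule XD(4)[OF iseq])
      ultimately show "gE js * gT k * gE is \<in> transporter U ?Z"
        using js iseq k additive_subgroupD(2)[OF Z] by (auto simp: transporter_def F_closed)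
    qed
  qed
  moreover have "gY t \<in> transporter ?Z ?Z" if t: "t < size \<nu>" for t
  proof (rule transporter_step[OF Z XD(2) k])
    show "gY t \<in> transporter U ?Z" by (rule into) (rule XD(5)[OF t])
    show "gY t * gT k \<in> transporter U ?Z"
    proof (rule transporter_weightwise[OF Z XD(2)])
      show "gY t * gT k \<in> carrier F" using t k by (intro F_closed)
      fix "is" assume iseq: "is \<in> seqs"
      define n where "n = par (is ! k) * par (is ! Suc k)"
      define \<delta> :: "('v, 'k) spin_free" where "\<delta> = (if is ! k = is ! Suc k then 1 else 0)"
      have \<delta>: "\<delta> \<in> transporter U U"
        using transporter_one transporter_group XD(1,2) by (simp add: \<delta>_def)
      have \<delta>E: "\<delta> * gE is \<in> transporter U ?Z" by (rule into) (rule tm[OF \<delta> XD(4)[OF iseq]])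
      have \<delta>c: "\<delta> \<in> carrier F" using \<delta> by (rule transporterD)
      have TYE: "gT k * gY s * gE is \<in> transporter U ?Z" if "s < size \<nu>" for s
        unfolding mult.assoc by (rule T_into) (rule tm[OF XD(5)[OF that] XD(4)[OF iseq]])
      consider "t \<noteq> k" "t \<noteq> Suc k" | "t = k" | "t = Suc k" by blast
      then show "gY t * gT k * gE is \<in> transporter U ?Z"
      proof cases
        case 1
        have "gT k * gY t * gE is - (- 1) ^ (par (is ! k) * par (is ! Suc k) * par (is ! t)) * gY t * gT k * gE is
            \<in> relators \<nu>"
          unfolding relators_def Let_def using k t iseq 1 by blast
        from transporter_cong[OF this, of U ?Z] TYE[OF t] show ?thesis
          using k t iseq by (simp add: mult.assoc ts F_closed)
      next
        case 2
        \<comment> \<open>The relation is read backwards: the dot on the left of the crossing is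
          expressed by the dot on its right.\<close>
        have "gT k * gY (Suc k) * gE is - ((- 1) ^ n * gY k * gT k + \<delta>) * gE is \<in> relators \<nu>"
          unfolding relators_def Let_def n_def \<delta>_def using k iseq by blast
        from transporter_cong[OF this, of U ?Z] TYE[OF k]
        have "((- 1) ^ n * gY k * gT k + \<delta>) * gE is \<in> transporter U ?Z"
          using k t iseq \<delta>c by (simp add: F_closed)
        from tg(4)[OF this \<delta>E] show ?thesis
          by (simp add: 2 distrib_right mult.assoc ts)
      next
        case 3
        have "gY (Suc k) * gT k * gE is - ((- 1) ^ n * gT k * gY k + \<delta>) * gE is \<in> relators \<nu>"
          unfolding relators_def Let_def n_def \<delta>_def using k iseq by blast
        note cong = transporter_cong[OF this, of U ?Z]
        have "(- 1) ^ n * gT k * gY k * gE is \<in> transporter U ?Z"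
          using TYE[of k] k by (simp add: ts mult.assoc)
        from tg(2)[OF this \<delta>E] show ?thesis
          using k t iseq \<delta>c cong by (simp add: 3 distrib_right F_closed)
      qed
    qed
  qed
  ultimately show ?thesis
    using Z unfolding polynomial_stable_def transporter_def by blast
qed

text \<open>The square of a crossing is a polynomial in the dots, so a second application falls back
  into \<open>U\<close>.\<close>

lemma step_stable_same:
  assumes U: "polynomial_stable U" and k: "Suc k < size \<nu>"
  shows "gT k \<in> transporter (step k U) (step k U)"
proof -
  note XD = polynomial_stableD[OF U]
  let ?Z = "step k U"
  have Z: "additive ?Z" by (rule additive_step[OF XD(1) k])
  show ?thesis
  proof (rule transporter_step[OF Z XD(2) k transporter_T_step[OF XD(1) k]])
    show "gT k * gT k \<in> transporter U ?Z"
    proof (rule transporter_weightwise[OF Z XD(2)])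
      show "gT k * gT k \<in> carrier F" using k by (intro F_closed)
      fix "is" assume iseq: "is \<in> seqs"
      let ?Q = "Q_poly (is ! k) (is ! Suc k) (gY k) (gY (Suc k)) :: ('v, 'k) spin_free"
      have Q: "?Q * gE is \<in> transporter U U"
        using k by (intro transporter_mult[OF XD(2) polynomial_stable_Q_poly[OF U XD(5) XD(5)] XD(4)[OF iseq]]) auto
      have "gT k * gT k * gE is - ?Q * gE is \<in> relators \<nu>"
        unfolding relators_def Let_def using k iseq by blast
      from transporter_cong[OF this _ transporterD(2)[OF Q], of U ?Z]
      show "gT k * gT k * gE is \<in> transporter U ?Z"
        using k iseq transporter_sets[OF Q subset_refl step_superset[OF XD(1) k]] by (simp add: F_closed)
    qed
  qed
qed

lemma step_stable_far:
  assumes U: "polynomial_stable U" and k: "Suc k < size \<nu>" and r: "Suc r < size \<nu>"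
    and far: "Suc r < k \<or> Suc k < r" and stable: "gT r \<in> transporter U U"
  shows "gT r \<in> transporter (step k U) (step k U)"
proof -
  note XD = polynomial_stableD[OF U]
  let ?Z = "step k U"
  have Z: "additive ?Z" by (rule additive_step[OF XD(1) k])
  show ?thesis
  proof (rule transporter_step[OF Z XD(2) k])
    show "gT r \<in> transporter U ?Z"
      by (rule transporter_sets[OF stable subset_refl step_superset[OF XD(1) k]])
    show "gT r * gT k \<in> transporter U ?Z"
    proof (rule transporter_weightwise[OF Z XD(2)])
      show "gT r * gT k \<in> carrier F" using k r by (intro F_closed)
      fix "is" assume iseq: "is \<in> seqs"
      have "gT r * gT k * gE is
          - (- 1) ^ (par (is ! r) * par (is ! Suc r) * par (is ! k) * par (is ! Suc k)) * gT k * gT r * gE is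
          \<in> relators \<nu>"
        unfolding relators_def Let_def using k r iseq far by blast
      note cong = transporter_cong[OF this, of U ?Z]
      have "gT k * (gT r * gE is) \<in> transporter U ?Z"
        by (rule transporter_mult[OF XD(2) transporter_T_step[OF XD(1) k]
              transporter_mult[OF XD(2) stable XD(4)[OF iseq]]])
      then show "gT r * gT k * gE is \<in> transporter U ?Z"
        using cong k r iseq by (simp add: mult.assoc transporter_sign[OF Z XD(2)] F_closed)
    qed
  qed
qed

text \<open>Write \<open>s\<close> and \<open>t\<close> for the crossings \<open>k\<close> and
  \<open>Suc k\<close>. The critical term is \<open>t s t U\<close>. By the braid relation it lies
  in \<open>s t s U\<close> plus a polynomial image of \<open>U\<close>, and
  \<open>s U \<subseteq> U\<close> places \<open>s t s U\<close> inside \<open>s t U\<close>, which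
  has been adjoined. The term \<open>t s U\<close> lies in \<open>t U\<close> for the same
  reason.\<close>

lemma step_stable_braid:
  assumes U: "polynomial_stable U" and k: "Suc (Suc k) < size \<nu>"
    and stable_k: "gT k \<in> transporter U U"
  shows "gT (Suc k) \<in> transporter (step k (step (Suc k) U)) (step k (step (Suc k) U))"
proof -
  note XD = polynomial_stableD[OF U]
  have k': "Suc k < size \<nu>" using k by simp
  let ?Y = "step (Suc k) U"
  let ?Z = "step k ?Y"
  have Y: "polynomial_stable ?Y" by (rule polynomial_stable_step[OF U k])
  note YD = polynomial_stableD[OF Y]
  have Z: "additive ?Z" by (rule additive_step[OF YD(1) k'])
  have XY: "U \<subseteq> ?Y" by (rule step_superset[OF XD(1) k])
  have YZ: "?Y \<subseteq> ?Z" by (rule step_superset[OF YD(1) k'])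
  have T1: "gT (Suc k) \<in> transporter ?Y ?Y" by (rule step_stable_same[OF U k])
  have T1': "gT (Suc k) \<in> transporter U ?Y" by (rule transporter_T_step[OF XD(1) k])
  have T0: "gT k \<in> transporter ?Y ?Z" by (rule transporter_T_step[OF YD(1) k'])
  note tm = transporter_mult[OF XD(2)]
  show ?thesis
  proof (rule transporter_step[OF Z YD(2) k'])
    show "gT (Suc k) \<in> transporter ?Y ?Z" by (rule transporter_sets[OF T1 subset_refl YZ])
    show "gT (Suc k) * gT k \<in> transporter ?Y ?Z"
    proof (rule transporter_step[OF Z XD(2) k])
      have "gT (Suc k) * gT k \<in> transporter U ?Y" by (rule tm[OF T1' stable_k])
      then show "gT (Suc k) * gT k \<in> transporter U ?Z" by (rule transporter_sets[OF _ subset_refl YZ])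
      show "gT (Suc k) * gT k * gT (Suc k) \<in> transporter U ?Z"
      proof (rule transporter_weightwise[OF Z XD(2)])
        show "gT (Suc k) * gT k * gT (Suc k) \<in> carrier F" using k k' by (intro F_closed)
        fix "is" assume iseq: "is \<in> seqs"
        define C :: "('v, 'k) spin_free" where "C =
          (if is ! k = is ! Suc (Suc k) then
             (if par (is ! k) = 0
              then Q_quot0 (is ! k) (is ! Suc k) (gY (Suc (Suc k))) (gY k) (gY (Suc k))
              else (- 1) ^ par (is ! Suc k) * (gY (Suc (Suc k)) - gY k) *
                   Q_quot1 (is ! k) (is ! Suc k) (gY (Suc (Suc k))) (gY k) (gY (Suc k)))
           else 0)"
        have "C \<in> transporter U U"
        proof -
          have y: "gY k \<in> transporter U U" "gY (Suc k) \<in> transporter U U" "gY (Suc (Suc k)) \<in> transporter U U"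
            using k by (auto intro: XD)
          note quot = polynomial_stable_Q_quot[OF U y(3,1,2)]
          have "(gY (Suc (Suc k)) - gY k) * Q_quot1 i j (gY (Suc (Suc k))) (gY k) (gY (Suc k)) \<in> transporter U U" for i j
            by (rule tm[OF transporter_group(4)[OF XD(1,2) y(3,1)] quot(2)])
          then show ?thesis
            unfolding C_def using quot(1) transporter_group(1)[OF XD(1,2)]
            by (simp add: mult.assoc transporter_sign[OF XD(1,2)])
        qed
        then have "C * gE is \<in> transporter U U" by (rule tm) (rule XD(4)[OF iseq])
        then have C: "C * gE is \<in> transporter U ?Z" by (rule transporter_sets[OF _ subset_refl subset_trans[OF XY YZ]])
        have "(gT k * gT (Suc k) * gT k - gT (Suc k) * gT k * gT (Suc k)) * gE is - C * gE is \<in> relators \<nu>"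
          unfolding relators_def Let_def C_def using k iseq by blast
        from transporter_cong[OF this _ transporterD(2)[OF C], of U ?Z] C
        have D: "(gT k * gT (Suc k) * gT k - gT (Suc k) * gT k * gT (Suc k)) * gE is \<in> transporter U ?Z"
          using k k' iseq by (simp add: F_closed)
        have "gT k * (gT (Suc k) * (gT k * gE is)) \<in> transporter U ?Z"
          by (rule tm[OF T0 tm[OF T1' tm[OF stable_k XD(4)[OF iseq]]]])
        from transporter_group(4)[OF Z XD(2) this D]
        show "gT (Suc k) * gT k * gT (Suc k) * gE is \<in> transporter U ?Z"
          by (simp add: left_diff_distrib mult.assoc)
      qed
    qed
  qed
qed

text \<open>The products of the crossings \<open>k, \<dots>, m\<close> are the minimal left coset
  representatives of one symmetric group in the next, which is why the indices descend from
  \<open>m\<close>.\<close>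

primrec chain :: "'m set \<Rightarrow> nat \<Rightarrow> nat \<Rightarrow> 'm set" where
  "chain U m 0 = U"
| "chain U m (Suc j) = step (m - j) (chain U m j)"

text \<open>The one crossing not yet known to be stable moves down from \<open>m\<close> to 0 and
  then disappears. Strong induction is used because the braid argument looks two links back.\<close>

lemma chain_stable:
  assumes U: "polynomial_stable U" and m: "Suc m < size \<nu>"
    and stable: "\<And>r. r < m \<Longrightarrow> gT r \<in> transporter U U"
  shows "j \<le> Suc m \<Longrightarrow> polynomial_stable (chain U m j) \<and>
    (\<forall>r \<le> m. r + j \<noteq> m \<longrightarrow> gT r \<in> transporter (chain U m j) (chain U m j))"
proof (induction j rule: less_induct)
  case (less j)
  show ?case
  proof (cases j)
    case 0
    then show ?thesis using U stable by simp
  next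
    case (Suc i)
    define k where "k = m - i"
    have i: "i \<le> m" "k + i = m" using less.prems Suc by (auto simp: k_def)
    have k: "Suc k < size \<nu>" using i m by simp
    have chain: "chain U m j = step k (chain U m i)" by (simp add: Suc k_def)
    have IH: "polynomial_stable (chain U m i)"
      "r \<le> m \<Longrightarrow> r + i \<noteq> m \<Longrightarrow> gT r \<in> transporter (chain U m i) (chain U m i)" for r
      using less.IH[of i] Suc i by auto
    have "gT r \<in> transporter (step k (chain U m i)) (step k (chain U m i))"
      if r: "r \<le> m" "r + j \<noteq> m" for r
    proof -
      \<comment> \<open>The lower neighbour of \<open>k\<close> is precisely the index excluded at
        stage \<open>j\<close>.\<close>
      have "Suc r \<noteq> k" using r i Suc by auto
      then consider "r = k" | "Suc r < k \<or> Suc k < r" | "r = Suc k" by linarith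
      then show ?thesis
      proof cases
        case 1
        then show ?thesis using step_stable_same[OF IH(1) k] by simp
      next
        case 2
        then show ?thesis
          using r i m by (intro step_stable_far[OF IH(1) k] IH(2)) auto
      next
        case 3
        \<comment> \<open>The upper neighbour of \<open>k\<close> was adjoined one link earlier;
          before that link, \<open>gT k\<close> was already stable.\<close>
        then obtain i' where i': "i = Suc i'" using i r by (cases i) auto
        have "polynomial_stable (chain U m i')" "gT k \<in> transporter (chain U m i') (chain U m i')"
          using less.IH[of i'] Suc i i' by auto
        moreover have "chain U m i = step (Suc k) (chain U m i')"
          using i i' by (simp add: Suc_diff_Suc k_def)
        moreover have "Suc (Suc k) < size \<nu>" using 3 r m by simp
        ultimately show ?thesis using step_stable_braid[of "chain U m i'" k] 3 by simp
      qed
    qed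
    then show ?thesis
      unfolding chain using polynomial_stable_step[OF IH(1) k] by blast
  qed
qed

section \<open>Truncations from below and the lower bound for the degrees\<close>

definition low :: "int \<Rightarrow> 'm set" where
  "low B = {x \<in> carrier M. \<forall>d. fst d < B \<longrightarrow> component x d = \<zero>\<^bsub>M\<^esub>}"

lemma lowD: "x \<in> low B \<Longrightarrow> x \<in> carrier M" "x \<in> low B \<Longrightarrow> fst d < B \<Longrightarrow> component x d = \<zero>\<^bsub>M\<^esub>"
  unfolding low_def by blast+

lemma low_mono: "B' \<le> B \<Longrightarrow> low B \<subseteq> low B'"
  by (auto simp: low_def)

lemma additive_low: "additive (low B)"
  by (rule additive_subgroupI) (auto simp: low_def component_zero component_add component_minus)

lemma low_carrier: "low B \<subseteq> carrier M"
  by (auto simp: low_def)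

lemma homogeneous_low:
  assumes "homogeneous \<nu> c f" "B' \<le> B + fst c"
  shows "f \<in> transporter (low B) (low B')"
  unfolding transporter_def
proof (intro CollectI conjI ballI)
  show f: "f \<in> carrier F" by (rule homogeneous_closed[OF assms(1)])
  fix x assume x: "x \<in> low B"
  then have xc: "x \<in> carrier M" by (simp add: low_def)
  have "component (act f x) d = \<zero>\<^bsub>M\<^esub>" if d: "fst d < B'" for d
  proof -
    have "fst (d - c) < B" using d assms(2) by simp
    with x have "component x (d - c) = \<zero>\<^bsub>M\<^esub>" by (rule lowD)
    then show ?thesis by (simp add: component_act[OF assms(1) xc] act_zero_right f)
  qed
  then show "act f x \<in> low B'" using f xc by (simp add: low_def act_closed)
qed

lemma polynomial_stable_low: "polynomial_stable (low B)"
proof -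
  have "scalar b \<in> transporter (low B) (low B)" for b
    \<comment> \<open>A bare scalar is not among the \<open>homogeneous\<close> elements, but its
      products with idempotents are.\<close>
    by (rule transporter_weightwise[OF additive_low low_carrier])
      (auto intro: F_closed homogeneous_low[OF homogeneous.scale[OF homogeneous.idem]])
  moreover have "gE is \<in> transporter (low B) (low B)" if "is \<in> seqs" for "is"
    by (rule homogeneous_low[OF homogeneous.idem[OF that]]) simp
  moreover have "gY r \<in> transporter (low B) (low B)" if "r < size \<nu>" for r
  proof (rule transporter_weightwise[OF additive_low low_carrier gY_closed[OF that]])
    fix "is" assume "is \<in> seqs"
    then show "gY r * gE is \<in> transporter (low B) (low B)"
      using that by (intro homogeneous_low[OF homogeneous.dot]) (simp_all add: form_def)
  qed
  ultimately show ?thesis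
    using additive_low unfolding polynomial_stable_def transporter_def by blast
qed

text \<open>A crossing has one of finitely many degrees, according to the weight; \<open>C\<close>
  bounds all their absolute values at once.\<close>

lemma step_low:
  assumes "U \<subseteq> low B" "Suc k < size \<nu>"
  shows "\<exists>B'. step k U \<subseteq> low B'"
proof
  define C where "C = (\<Sum>is\<in>seqs. \<bar>form (is ! k) (is ! Suc k)\<bar>)"
  have T: "gT k \<in> transporter (low B) (low (B - C))"
  proof (rule transporter_weightwise[OF additive_low low_carrier gT_closed[OF assms(2)]])
    fix "is" assume iseq: "is \<in> seqs"
    have "\<bar>form (is ! k) (is ! Suc k)\<bar> \<le> C"
      unfolding C_def by (rule member_le_sum[OF iseq]) auto
    then show "gT k * gE is \<in> transporter (low B) (low (B - C))"
      by (intro homogeneous_low[OF homogeneous.crossing[OF iseq assms(2)]]) simp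
  qed
  have "C \<ge> 0" unfolding C_def by (rule sum_nonneg) simp
  then have "low B \<subseteq> low (B - C)" by (intro low_mono) simp
  then show "step k U \<subseteq> low (B - C)"
    using assms(1) additive_subgroupD(4)[OF additive_low] transporterD(1)[OF T] by (auto simp: step_def subset_iff)
qed

lemma chain_low:
  assumes "polynomial_stable U" "Suc m < size \<nu>" "\<And>r. r < m \<Longrightarrow> gT r \<in> transporter U U" "U \<subseteq> low B"
  shows "j \<le> Suc m \<Longrightarrow> U \<subseteq> chain U m j \<and> (\<exists>B'. chain U m j \<subseteq> low B')"
proof (induction j)
  case 0
  then show ?case using assms(4) by auto
next
  case (Suc j)
  have "polynomial_stable (chain U m j)"
    using chain_stable[OF assms(1-3), of j] Suc.prems by simp
  moreover have "Suc (m - j) < size \<nu>" using assms(2) by simp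
  ultimately show ?case
    using Suc step_superset[of "chain U m j" "m - j"] step_low[of "chain U m j" _ "m - j"]
      polynomial_stableD(1)[of "chain U m j"] by auto
qed

text \<open>One crossing is made stable at a time, each by a chain that preserves the earlier ones
  and lowers the bound by a finite amount.\<close>

lemma stable_extension:
  "\<exists>U B'. polynomial_stable U \<and> low B \<subseteq> U \<and> U \<subseteq> low B' \<and>
    (\<forall>r < m. Suc r < size \<nu> \<longrightarrow> gT r \<in> transporter U U)"
proof (induction m)
  case 0
  then show ?case using polynomial_stable_low by blast
next
  case (Suc m)
  then obtain U B' where U: "polynomial_stable U" "low B \<subseteq> U" "U \<subseteq> low B'"
    "\<And>r. r < m \<Longrightarrow> Suc r < size \<nu> \<Longrightarrow> gT r \<in> transporter U U" by blast
  show ?case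
  proof (cases "Suc m < size \<nu>")
    case True
    let ?V = "chain U m (Suc m)"
    have stable: "gT r \<in> transporter U U" if "r < m" for r using U(4) that True by simp
    have "polynomial_stable ?V" "\<forall>r < Suc m. gT r \<in> transporter ?V ?V"
      using chain_stable[OF U(1) True stable, of "Suc m"] by auto
    moreover have "low B \<subseteq> ?V" "\<exists>B'. ?V \<subseteq> low B'"
      using chain_low[OF U(1) True stable U(3), of "Suc m"] U(2) by blast+
    ultimately show ?thesis by blast
  next
    case False
    then show ?thesis using U by (metis less_Suc_eq)
  qed
qed

text \<open>The finitely many generators have finitely many components, so some \<open>low B\<close>
  contains them. Its stable extension is then a submodule containing the generators, hence all of
  \<open>M\<close>, and still bounded below.\<close>

lemma bounded_below: "\<exists>B. carrier M \<subseteq> low B"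
proof -
  have "finitely_generated_module H M" using graded by (simp add: graded_module_def)
  then obtain S where "finite S \<and> S \<subseteq> carrier M \<and> (\<forall>N. submodule N H M \<and> S \<subseteq> N \<longrightarrow> N = carrier M)"
    unfolding finitely_generated_module_def by (elim exE)
  then have S: "finite S" "S \<subseteq> carrier M" "\<And>N. submodule N H M \<Longrightarrow> S \<subseteq> N \<Longrightarrow> N = carrier M"
    by simp_all
  define D where "D = fst ` (\<Union>x\<in>S. {d. component x d \<noteq> \<zero>\<^bsub>M\<^esub>})"
  have "finite D" unfolding D_def using S(1,2) finite_component by auto
  then obtain B where B: "\<And>c. c \<in> D \<Longrightarrow> B \<le> c"
    using bdd_below_finite[of D] unfolding bdd_below_def by blast
  have "S \<subseteq> low B"
  proof
    fix x assume x: "x \<in> S"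
    then have "component x d = \<zero>\<^bsub>M\<^esub>" if "fst d < B" for d
      using B[of "fst d"] that by (force simp: D_def)
    then show "x \<in> low B" using x S(2) by (auto simp: low_def)
  qed
  moreover obtain U B' where U: "polynomial_stable U" "low B \<subseteq> U" "U \<subseteq> low B'"
    "\<And>r. Suc r < size \<nu> \<Longrightarrow> gT r \<in> transporter U U"
    using stable_extension[of B "size \<nu>"] by auto
  note UD = polynomial_stableD[OF U(1)]
  have F: "f \<in> transporter U U" if "f \<in> carrier F" for f
    using that
  proof (induction f rule: free_algebra_induct)
    case (letter g)
    then show ?case using UD U(4) by (auto simp: generators_def)
  qed (use UD transporter_group[OF UD(1,2)] transporter_mult[OF UD(2)] in auto)
  have "submodule U H M"
  proof (rule submoduleI)
    fix a x assume "a \<in> carrier H" "x \<in> U"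
    then show "a \<odot>\<^bsub>M\<^esub> x \<in> U"
      using F by (auto simp: carrier_H act_def transporter_def)
  qed (use additive_subgroupD[OF UD(1)] in auto)
  ultimately have "U = carrier M" using S(3) U(2) by blast
  then show ?thesis using U(3) by blast
qed

section \<open>Purity, transitivity and ungraded submodules\<close>

lemma exists_weight:
  assumes "x \<in> carrier M" "x \<noteq> \<zero>\<^bsub>M\<^esub>"
  shows "\<exists>is \<in> seqs. act (gE is) x \<noteq> \<zero>\<^bsub>M\<^esub>"
proof (rule ccontr)
  assume "\<not> ?thesis"
  then have "finsum M (\<lambda>is. act (gE is) x) seqs = finsum M (\<lambda>is. \<zero>\<^bsub>M\<^esub>) seqs"
    by (intro M.finsum_cong') auto
  then show False using act_E_sum[OF assms(1)] assms(2) by simp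
qed

lemma exists_component:
  assumes "x \<in> carrier M" "x \<noteq> \<zero>\<^bsub>M\<^esub>"
  shows "\<exists>d. component x d \<noteq> \<zero>\<^bsub>M\<^esub>"
  using component_inject[OF assms(1) M.zero_closed] assms(2) component_zero by auto

lemma nonzero: "\<exists>x \<in> carrier M. x \<noteq> \<zero>\<^bsub>M\<^esub>"
  using simple M.zero_closed by (auto simp: graded_simple_def)

lemma pure: "\<exists>t. pure_part t = Md"
proof -
  obtain x where x: "x \<in> carrier M" "x \<noteq> \<zero>\<^bsub>M\<^esub>" using nonzero by blast
  obtain d where d: "component x d \<noteq> \<zero>\<^bsub>M\<^esub>" using exists_component[OF x] by blast
  obtain "is" where iseq: "is \<in> seqs" and y: "act (gE is) (component x d) \<noteq> \<zero>\<^bsub>M\<^esub>"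
    using exists_weight[OF component_closed[OF x(1)] d] by blast
  \<comment> \<open>The shift is read off from one nonzero homogeneous weight vector, which thereby
    becomes the nonzero member of the family.\<close>
  obtain t where t: "snd d = expected_parity (fst d) is + t"
    by (metis add.commute diff_add_cancel)
  have mem: "act (gE is) (component x d) \<in> Md d"
    using act_homogeneous[OF homogeneous.idem[OF iseq] component_mem[OF x(1)]]
    by (simp flip: zero_prod_def)
  have "pure_part t = Md"
  proof (rule graded_simple_family[OF simple])
    show "pure_part t d \<subseteq> Md d" for d by (auto simp: pure_part_def)
    show "\<zero>\<^bsub>M\<^esub> \<in> pure_part t d" for d
      by (auto simp: pure_part_def Md_closed act_zero_right gE_closed)
    show "\<ominus>\<^bsub>M\<^esub> x \<in> pure_part t d" if "x \<in> pure_part t d" for d x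
      using that pure_part_carrier[OF that] by (auto simp: pure_part_def Md_closed act_minus_right gE_closed)
    show "x \<oplus>\<^bsub>M\<^esub> y \<in> pure_part t d" if "x \<in> pure_part t d" "y \<in> pure_part t d" for d x y
      using that pure_part_carrier[OF that(1)] pure_part_carrier[OF that(2)]
      by (auto simp: pure_part_def Md_closed act_add_right gE_closed)
    show "r \<odot>\<^bsub>M\<^esub> x \<in> pure_part t (c + d)" if "r \<in> Hd c" "x \<in> pure_part t d" for c d r x
    proof -
      obtain f where "homogeneous \<nu> c f" "r = proj f" using \<open>r \<in> Hd c\<close> by (auto simp: component_eq)
      then show ?thesis using pure_part_homogeneous[OF _ \<open>x \<in> pure_part t d\<close>] by (simp add: act_def)
    qed
    show "act (gE is) (component x d) \<in> pure_part t d"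
      using mem t iseq act_E_E[OF iseq _ component_closed[OF x(1)]] by (auto simp: pure_part_def)
    show "act (gE is) (component x d) \<noteq> \<zero>\<^bsub>M\<^esub>" by (rule y)
  qed
  then show ?thesis ..
qed

lemma transitive:
  assumes "x \<in> Md d" "x \<noteq> \<zero>\<^bsub>M\<^esub>" "z \<in> Md d'"
  shows "\<exists>r \<in> Hd (d' - d). z = r \<odot>\<^bsub>M\<^esub> x"
  by (rule graded_simple_transitive[OF simple component_add_H component_minus_H component_zero_H
        component_mult_H component_one_H assms])

lemma lowest_degree:
  "\<exists>d z. z \<in> Md d \<and> z \<noteq> \<zero>\<^bsub>M\<^esub> \<and> (\<forall>d' z'. z' \<in> Md d' \<longrightarrow> fst d' < fst d \<longrightarrow> z' = \<zero>\<^bsub>M\<^esub>)"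
proof -
  let ?P = "\<lambda>d. \<exists>z \<in> Md d. z \<noteq> \<zero>\<^bsub>M\<^esub>"
  obtain B where B: "carrier M \<subseteq> low B" using bounded_below by blast
  have ge: "B \<le> fst d" if z: "z \<in> Md d" "z \<noteq> \<zero>\<^bsub>M\<^esub>" for d z
  proof (rule ccontr)
    assume "\<not> B \<le> fst d"
    moreover have "z \<in> low B" using B Md_closed(1)[OF z(1)] by blast
    ultimately have "component z d = \<zero>\<^bsub>M\<^esub>" using lowD(2)[of z B d] by simp
    then show False using z by (simp add: component_homogeneous)
  qed
  obtain x where "x \<in> carrier M" "x \<noteq> \<zero>\<^bsub>M\<^esub>" using nonzero by blast
  then obtain d0 where "component x d0 \<noteq> \<zero>\<^bsub>M\<^esub>" "component x d0 \<in> Md d0"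
    using exists_component component_mem by blast
  then have "?P d0" by blast
  \<comment> \<open>Truncation by \<open>nat\<close> loses nothing, since degrees with nonzero
    vectors are at least \<open>B\<close>.\<close>
  from ex_has_least_nat[of ?P, OF this, of "\<lambda>d. nat (fst d - B)"]
  obtain d where d: "?P d" "\<forall>d'. ?P d' \<longrightarrow> nat (fst d - B) \<le> nat (fst d' - B)"
    by (elim exE conjE)
  then obtain z where z: "z \<in> Md d" "z \<noteq> \<zero>\<^bsub>M\<^esub>" by (elim bexE)
  have "z' = \<zero>\<^bsub>M\<^esub>" if z': "z' \<in> Md d'" "fst d' < fst d" for d' z'
  proof (rule ccontr)
    assume ne: "z' \<noteq> \<zero>\<^bsub>M\<^esub>"
    have "nat (fst d - B) \<le> nat (fst d' - B)"
      using ne z'(1) by (intro d(2)[rule_format] bexI[of _ z'])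
    then show False using ge[OF z'(1) ne] ge[OF z] z'(2) by linarith
  qed
  then show ?thesis using z by blast
qed

text \<open>A vector of lowest degree reached from the top component of a weight vector receives no contribution
  from its other components, which would land in even lower degrees.\<close>

lemma submodule_trivial:
  assumes "submodule N H M" "N \<noteq> {\<zero>\<^bsub>M\<^esub>}"
  shows "N = carrier M"
proof -
  note N = submoduleE[OF assms(1)]
  have "\<not> N \<subseteq> {\<zero>\<^bsub>M\<^esub>}" using assms(2) N(2) by auto
  then obtain x where x: "x \<in> N" "x \<noteq> \<zero>\<^bsub>M\<^esub>" by auto
  have xc: "x \<in> carrier M" using x N(1) by blast
  obtain "is" where iseq: "is \<in> seqs" and y0: "act (gE is) x \<noteq> \<zero>\<^bsub>M\<^esub>"
    using exists_weight[OF xc x(2)] by blast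
  define y where "y = act (gE is) x"
  have yN: "y \<in> N" unfolding y_def act_def by (rule N(3)) (use proj_closed gE_closed iseq x in auto)
  then have yc: "y \<in> carrier M" using N(1) by blast
  obtain t where t: "pure_part t = Md" using pure by blast
  let ?D = "{d. component y d \<noteq> \<zero>\<^bsub>M\<^esub>}"
  \<comment> \<open>The components of \<open>y\<close> stay in the weight \<open>is\<close>, because
    the idempotent has degree zero; purity then fixes their parities.\<close>
  have parity: "snd d = expected_parity (fst d) is + t" if "d \<in> ?D" for d
  proof -
    have "component y d = act (gE is) (component x d)"
      unfolding y_def using component_act[OF homogeneous.idem[OF iseq] xc, of d]
      by (simp flip: zero_prod_def)
    moreover have "component x d \<in> pure_part t d" using component_mem[OF xc] t by simp
    ultimately show ?thesis using that iseq by (auto simp: pure_part_def)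
  qed
  have fin: "finite (fst ` ?D)" using finite_component[OF yc] by simp
  moreover have "fst ` ?D \<noteq> {}" using exists_component[OF yc] y0 by (auto simp: y_def)
  ultimately have "Max (fst ` ?D) \<in> fst ` ?D" by (rule Max_in)
  then obtain d1 where d1: "Max (fst ` ?D) = fst d1" "d1 \<in> ?D" by (rule imageE)
  have less: "fst d < fst d1" if d: "d \<in> ?D" "d \<noteq> d1" for d
  proof -
    have "fst d \<le> fst d1" unfolding d1(1)[symmetric] using fin d(1) by (intro Max_ge) auto
    \<comment> \<open>Equal integer degrees would force equal parities and hence equal
      bidegrees.\<close>
    moreover have "fst d \<noteq> fst d1" using parity[OF d(1)] parity[OF d1(2)] d(2) by (auto simp: prod_eq_iff)
    ultimately show ?thesis by simp
  qed
  obtain d' z where z: "z \<in> Md d'" "z \<noteq> \<zero>\<^bsub>M\<^esub>" and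
    least: "\<And>d z'. z' \<in> Md d \<Longrightarrow> fst d < fst d' \<Longrightarrow> z' = \<zero>\<^bsub>M\<^esub>"
    using lowest_degree by blast
  \<comment> \<open>\<open>r\<close> is chosen for the top component alone; the other components of
    \<open>y\<close> do not influence the choice.\<close>
  obtain r where r: "r \<in> Hd (d' - d1)" "z = r \<odot>\<^bsub>M\<^esub> component y d1"
    using transitive[OF component_mem[OF yc, of d1] _ z(1)] d1(2) by auto
  have rc: "r \<in> carrier H" using r(1) component_carrier by blast
  have "r \<odot>\<^bsub>M\<^esub> y = z"
  proof (rule component_inject)
    show "r \<odot>\<^bsub>M\<^esub> y \<in> carrier M" by (rule smult_closed[OF rc yc])
    show "z \<in> carrier M" by (rule Md_closed(1)[OF z(1)])
    fix e
    let ?d = "e - (d' - d1)"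
    have e: "component (r \<odot>\<^bsub>M\<^esub> y) e = r \<odot>\<^bsub>M\<^esub> component y ?d" by (rule component_smult[OF r(1) yc])
    show "component (r \<odot>\<^bsub>M\<^esub> y) e = component z e"
    proof (cases "e = d'")
      case True
      then show ?thesis unfolding e using r(2) z(1) by (simp add: component_homogeneous)
    next
      case False
      then have ne: "?d \<noteq> d1" by (auto simp: algebra_simps)
      have "r \<odot>\<^bsub>M\<^esub> component y ?d = \<zero>\<^bsub>M\<^esub>"
      proof (cases "?d \<in> ?D")
        case True
        have "r \<odot>\<^bsub>M\<^esub> component y ?d \<in> Md (d' - d1 + ?d)"
          by (rule smult_Md[OF r(1) component_mem[OF yc]])
        then show ?thesis using least less[OF True ne] by simp
      qed (simp add: smult_zero_right rc)
      then show ?thesis unfolding e using z(1) False by (simp add: component_homogeneous)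
    qed
  qed
  then have zN: "z \<in> N" using N(3)[OF rc yN] by simp
  have "w \<in> N" if w: "w \<in> carrier M" for w
  proof -
    \<comment> \<open>Every homogeneous vector is a multiple of \<open>z\<close>, so
      \<open>N\<close> contains all components of \<open>w\<close>.\<close>
    have comp: "component w d \<in> N" for d
    proof -
      obtain s where "s \<in> Hd (d - d')" "component w d = s \<odot>\<^bsub>M\<^esub> z"
        using transitive[OF z component_mem[OF w], of d] by (rule bexE)
      then show ?thesis using N(3)[OF subsetD[OF component_carrier] zN] by simp
    qed
    have "finsum M (component w) {d. component w d \<noteq> \<zero>\<^bsub>M\<^esub>} \<in> N"
      by (rule additive_finsum[OF submodule.axioms(1)[OF assms(1)] comp])
    then show ?thesis using finsum_component[OF w finite_component[OF w] subset_refl] by simp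
  qed
  then show ?thesis using N(1) by blast
qed

lemma type_M: "type_M H M"
  unfolding type_M_def simple_module_def
  using submodule_trivial nonzero left_module_axioms by blast

text \<open>A submodule homogeneous for the integer grading is in particular a submodule, and those
  are already known to be trivial.\<close>

lemma graded_simple_forget_parity: "graded_simple H (forget_parity H Hd) M (forget_parity M Md)"
  unfolding graded_simple_def
  using submodule_trivial nonzero graded_module_forget_parity[OF graded_left_module_axioms]
  by (auto simp: graded_submodule_def)

end

theorem proposition6p15:
  fixes \<Gamma> :: "('v, 'h) pre_digraph" and aV :: "'v \<Rightarrow> 'v" and aE :: "'h \<Rightarrow> 'h" and I :: "'v set"
    and \<nu> :: "'v multiset"
    and H :: "('v, 'k::field) spin_free set ring" and Hd :: "int \<times> bit \<Rightarrow> ('v, 'k) spin_free set set"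
    and M :: "(('v, 'k) spin_free set, 'm) module" and Md :: "int \<times> bit \<Rightarrow> 'm set"
  assumes "CHAR('k) \<noteq> 2"
    and "spin_quiver \<Gamma> aV aE I"
    and "set_mset \<nu> \<subseteq> I"
    and "H = quiver_automorphism.spin_algebra \<Gamma> aV aE \<nu>"
    and "Hd = quiver_automorphism.spin_component \<Gamma> aV aE \<nu>"
    and "graded_simple H Hd M Md"
  shows "type_M H M \<and> graded_simple H (forget_parity H Hd) M (forget_parity M Md)"
proof -
  have "spin_simple_module \<Gamma> aV aE I \<nu> M Md"
    using assms unfolding spin_simple_module_def spin_simple_module_axioms_def by simp
  then show ?thesis
    using spin_simple_module.type_M spin_simple_module.graded_simple_forget_parity
    unfolding assms(4,5) by blast
qed

end
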